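(* Let $(X,\mu)$ be a nonatomic probability space equipped with a tree $\mathcal{T}$, let $p,q>1$ and write $p'=\frac p{p-1}$, $q'=\frac q{q-1}$. For $F,f>0$ let $$\mathcal{BL}_{p,q}^{\mathcal{T}}(F,f)=\sup\left\{\|M_{\mathcal{T}}\phi\|_{L^{p,q}(X,\mu)}^q:\ \phi\ge0\text{ measurable on }X,\ \|\phi\|_{L^1(X,\mu)}=f,\ \|\phi\|_{L^{p,q}(X,\mu)}^q=F\right\}.$$ The domain of $\mathcal{BL}_{p,q}^{\mathcal{T}}$ (the set of pairs $(F,f)$ for which at least one such $\phi$ exists) consists of all pairs $(F,f)$ with (i) $0<f^q\le\left(\frac{p'}{q'}\right)^{q-1}F$ if $1<p\le q$; (ii) $0<f^q\le\frac qp F$ if $1<q<p$; and in both cases, for all $(F,f)$ in the domain, $$\mathcal{BL}_{p,q}^{\mathcal{T}}(F,f)=\left(\frac{p'}{q'}\right)^q\,\omega_q\!\left(\left(\frac{q'}{p'}\right)^{q-1}\frac{f^q}{F}\right)^{q}F,$$ where $\omega_q:[0,1]\to[1,q']$ is the inverse function of $H_q(z)=-(q-1)z^q+qz^{q-1}$, $z\in[1,q']$.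
   Context: Let $(X,\mu)$ be a nonatomic probability space. Two measurable sets $A,B\subseteq X$ are almost disjoint if $\mu(A\cap B)=0$. A set $\mathcal{T}$ of measurable subsets of $X$ is called a tree if: (i) $X\in\mathcal{T}$ and $\mu(I)>0$ for every $I\in\mathcal{T}$; (ii) for every $I\in\mathcal{T}$ there corresponds a finite subset $\mathcal{C}(I)\subseteq\mathcal{T}$ with at least two elements, whose elements are pairwise almost disjoint subsets of $I$ and such that $I=\bigcup\mathcal{C}(I)$; (iii) $\mathcal{T}=\bigcup_{m\ge0}\mathcal{T}_{(m)}$, where $\mathcal{T}_{(0)}=\{X\}$ and $\mathcal{T}_{(m+1)}=\bigcup_{I\in\mathcal{T}_{(m)}}\mathcal{C}(I)$; (iv) $\lim_{m\to\infty}\sup_{I\in\mathcal{T}_{(m)}}\mu(I)=0$. The associated maximal operator is $M_{\mathcal{T}}\phi(x)=\sup\{\frac1{\mu(I)}\int_I|\phi|\,d\mu: x\in I\in\mathcal{T}\}$ for $\phi\in L^1(X,\mu)$. For measurable $\psi$ on $X$, $\psi^*:(0,1]\to[0,+\infty]$ denotes the equimeasurable non-increasing (right-continuous) rearrangement of $|\psi|$. The Lorentz quasinorm is normalized by $\|\psi\|_{L^{p,q}(X,\mu)}^q=\int_0^1\left(t^{\frac1p}\psi^*(t)\right)^q\frac{dt}{t}$. *)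

theory Defs
  imports "HOL-Probability.Probability"
begin

definition nonatomic :: "'a measure \<Rightarrow> bool" where
  "nonatomic M \<longleftrightarrow>
     (\<forall>A\<in>sets M. 0 < emeasure M A \<longrightarrow>
        (\<exists>B\<in>sets M. B \<subseteq> A \<and> 0 < emeasure M B \<and> emeasure M B < emeasure M A))"

primrec tree_level :: "'a set \<Rightarrow> ('a set \<Rightarrow> 'a set set) \<Rightarrow> nat \<Rightarrow> 'a set set" where
  "tree_level X C 0 = {X}"
| "tree_level X C (Suc m) = (\<Union>I\<in>tree_level X C m. C I)"

definition measure_tree :: "'a measure \<Rightarrow> 'a set set \<Rightarrow> bool" where
  "measure_tree M T \<longleftrightarrow>
     T \<subseteq> sets M \<and> space M \<in> T \<and> (\<forall>I\<in>T. 0 < emeasure M I) \<and>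
     (\<exists>C. (\<forall>I\<in>T. C I \<subseteq> T \<and> finite (C I) \<and> 2 \<le> card (C I) \<and>
                  (\<forall>J\<in>C I. J \<subseteq> I) \<and>
                  pairwise (\<lambda>J K. emeasure M (J \<inter> K) = 0) (C I) \<and>
                  I = \<Union>(C I)) \<and>
          T = (\<Union>m. tree_level (space M) C m) \<and>
          (\<lambda>m. SUP I\<in>tree_level (space M) C m. emeasure M I) \<longlonglongrightarrow> 0)"

definition tree_maximal :: "'a measure \<Rightarrow> 'a set set \<Rightarrow> ('a \<Rightarrow> real) \<Rightarrow> 'a \<Rightarrow> ennreal" where
  "tree_maximal M T \<phi> x =
     (SUP I\<in>{I\<in>T. x \<in> I}. (\<integral>\<^sup>+y\<in>I. ennreal \<bar>\<phi> y\<bar> \<partial>M) / emeasure M I)"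

text \<open>
  Functions are taken with values in \<open>[0,\<infinity>]\<close>, since the maximal function may be infinite on a
  null set; \<open>\<psi>\<close> below plays the role of the absolute value of the function. The rearrangement is
  only meant to be evaluated on \<open>(0,1]\<close>; on a probability space the formula gives the value 0
  at \<open>t = 1\<close>, a single point that affects no integral. The absolute integral of \<open>\<phi>\<close> over \<open>I\<close> in
  \<open>tree_maximal\<close> is likewise taken in \<open>[0,\<infinity>]\<close>, and the supremum is over a nonempty family for
  every point of the space.
\<close>

definition rearrangement :: "'a measure \<Rightarrow> ('a \<Rightarrow> ennreal) \<Rightarrow> real \<Rightarrow> ennreal" where
  "rearrangement M \<psi> t = Inf {s. emeasure M {x\<in>space M. s < \<psi> x} \<le> ennreal t}"

text \<open>Real powers on \<open>[0,\<infinity>]\<close>, for positive exponents only.\<close>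

definition ennpowr :: "ennreal \<Rightarrow> real \<Rightarrow> ennreal" where
  "ennpowr a r = (if a = \<top> then \<top> else ennreal (enn2real a powr r))"

definition lorentz_norm :: "'a measure \<Rightarrow> real \<Rightarrow> real \<Rightarrow> ('a \<Rightarrow> ennreal) \<Rightarrow> ennreal" where
  "lorentz_norm M p q \<psi> =
     ennpowr (\<integral>\<^sup>+t\<in>{0<..1}. ennpowr (ennreal (t powr (1 / p)) * rearrangement M \<psi> t) q / ennreal t \<partial>lborel)
       (1 / q)"

lemma ennpowr_ennpowr_inverse: "r > 0 \<Longrightarrow> ennpowr (ennpowr a (1 / r)) r = a"
  by (cases a) (auto simp: ennpowr_def powr_powr)

lemma lorentz_norm_powr:
  "q > 0 \<Longrightarrow> ennpowr (lorentz_norm M p q \<psi>) q =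
     (\<integral>\<^sup>+t\<in>{0<..1}. ennpowr (ennreal (t powr (1 / p)) * rearrangement M \<psi> t) q / ennreal t \<partial>lborel)"
  by (simp add: lorentz_norm_def ennpowr_ennpowr_inverse)

lemma rearrangement_antimono: "s \<le> t \<Longrightarrow> rearrangement M \<psi> t \<le> rearrangement M \<psi> s"
  unfolding rearrangement_def
  by (intro Inf_superset_mono) (auto intro: order_trans ennreal_leI)

lemma less_rearrangement_iff:
  assumes [measurable]: "\<psi> \<in> borel_measurable M"
  shows "s < rearrangement M \<psi> t \<longleftrightarrow> ennreal t < emeasure M {x\<in>space M. s < \<psi> x}"
proof
  assume "s < rearrangement M \<psi> t"
  then show "ennreal t < emeasure M {x\<in>space M. s < \<psi> x}"
    unfolding rearrangement_def by (metis (mono_tags, lifting) Inf_lower mem_Collect_eq leD not_le)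
next
  assume t: "ennreal t < emeasure M {x\<in>space M. s < \<psi> x}"
  show "s < rearrangement M \<psi> t"
  proof (cases "s = \<top>")
    case True
    then show ?thesis using t by simp
  next
    case False
    define u where "u n = s + ennreal (1 / real (Suc n))" for n
    have u_gr: "s < u n" for n
      using False unfolding u_def
      by (cases s) (auto simp: ennreal_plus[symmetric] ennreal_less_iff simp del: ennreal_plus)
    have ex_u: "\<exists>n. u n < y" if "s < y" for y
    proof -
      have "(\<lambda>n. s + ennreal (1 / real (Suc n))) \<longlonglongrightarrow> s + ennreal 0"
        by (intro tendsto_add tendsto_const tendsto_ennrealI LIMSEQ_Suc lim_1_over_n)
      then have "\<forall>\<^sub>F n in sequentially. u n < y"
        using that unfolding u_def by (intro order_tendstoD) auto
      then show ?thesis by (auto simp: eventually_sequentially)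
    qed
    have u_mono: "u n \<le> u m" if "m \<le> n" for m n
      using that unfolding u_def by (intro add_left_mono ennreal_leI) (simp add: field_simps)
    have "{x\<in>space M. s < \<psi> x} = (\<Union>n. {x\<in>space M. u n < \<psi> x})"
      using ex_u u_gr by (auto intro: less_trans)
    moreover have "(SUP n. emeasure M {x\<in>space M. u n < \<psi> x}) = emeasure M (\<Union>n. {x\<in>space M. u n < \<psi> x})"
      by (rule SUP_emeasure_incseq) (auto simp: incseq_def intro: le_less_trans[OF u_mono])
    ultimately have "ennreal t < (SUP n. emeasure M {x\<in>space M. u n < \<psi> x})"
      using t by simp
    then obtain n where n: "ennreal t < emeasure M {x\<in>space M. u n < \<psi> x}"
      unfolding less_SUP_iff by blast
    have "u n \<le> rearrangement M \<psi> t"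
      unfolding rearrangement_def
    proof (rule Inf_greatest, rule ccontr)
      fix r assume r: "r \<in> {r. emeasure M {x\<in>space M. r < \<psi> x} \<le> ennreal t}" "\<not> u n \<le> r"
      then have "emeasure M {x\<in>space M. u n < \<psi> x} \<le> emeasure M {x\<in>space M. r < \<psi> x}"
        by (intro emeasure_mono) auto
      with n r show False by auto
    qed
    with u_gr show ?thesis by (rule less_le_trans)
  qed
qed

lemma rearrangement_equimeasurable:
  assumes "prob_space M" and [measurable]: "\<psi> \<in> borel_measurable M"
  shows "emeasure lborel {t\<in>{0<..1}. s < rearrangement M \<psi> t} = emeasure M {x\<in>space M. s < \<psi> x}"
proof -
  interpret prob_space M by fact
  define d where "d = prob {x\<in>space M. s < \<psi> x}"
  have d: "emeasure M {x\<in>space M. s < \<psi> x} = ennreal d" "0 \<le> d" "d \<le> 1"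
    by (auto simp: d_def emeasure_eq_measure)
  have "{t\<in>{0<..1}. s < rearrangement M \<psi> t} = {0<..<d}"
    using d by (auto simp: less_rearrangement_iff ennreal_less_iff)
  then show ?thesis using d by simp
qed

lemma rearrangement_right_continuous:
  assumes [measurable]: "\<psi> \<in> borel_measurable M" and "0 \<le> t"
  shows "(rearrangement M \<psi> \<longlongrightarrow> rearrangement M \<psi> t) (at_right t)"
proof (rule order_tendstoI)
  fix a assume "rearrangement M \<psi> t < a"
  then show "\<forall>\<^sub>F u in at_right t. rearrangement M \<psi> u < a"
    using rearrangement_antimono[of t _ M \<psi>]
    by (auto simp: eventually_at_filter intro!: always_eventually)
      (meson le_less_trans less_imp_le)
next
  fix a assume "a < rearrangement M \<psi> t"
  then have "ennreal t < emeasure M {x\<in>space M. a < \<psi> x}" by (simp add: less_rearrangement_iff)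
  moreover have "((\<lambda>u. ennreal u) \<longlongrightarrow> ennreal t) (at_right t)"
    by (intro tendsto_ennrealI tendsto_ident_at)
  ultimately have "\<forall>\<^sub>F u in at_right t. ennreal u < emeasure M {x\<in>space M. a < \<psi> x}"
    by (rule order_tendstoD(2)[rotated])
  then show "\<forall>\<^sub>F u in at_right t. a < rearrangement M \<psi> u"
    by eventually_elim (simp add: less_rearrangement_iff)
qed

definition bellman_admissible :: "'a measure \<Rightarrow> real \<Rightarrow> real \<Rightarrow> real \<Rightarrow> real \<Rightarrow> ('a \<Rightarrow> real) set" where
  "bellman_admissible M p q F f =
     {\<phi> \<in> borel_measurable M. (\<forall>x\<in>space M. 0 \<le> \<phi> x) \<and>
        (\<integral>\<^sup>+x. ennreal \<bar>\<phi> x\<bar> \<partial>M) = ennreal f \<and>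
        ennpowr (lorentz_norm M p q (\<lambda>x. ennreal \<bar>\<phi> x\<bar>)) q = ennreal F}"

definition bellman_domain :: "'a measure \<Rightarrow> real \<Rightarrow> real \<Rightarrow> (real \<times> real) set" where
  "bellman_domain M p q = {(F, f). 0 < F \<and> 0 < f \<and> bellman_admissible M p q F f \<noteq> {}}"

definition bellman :: "'a measure \<Rightarrow> 'a set set \<Rightarrow> real \<Rightarrow> real \<Rightarrow> real \<Rightarrow> real \<Rightarrow> ennreal" where
  "bellman M T p q F f =
     (SUP \<phi>\<in>bellman_admissible M p q F f. ennpowr (lorentz_norm M p q (tree_maximal M T \<phi>)) q)"

definition conj_exp :: "real \<Rightarrow> real" where
  "conj_exp r = r / (r - 1)"

definition bellman_H :: "real \<Rightarrow> real \<Rightarrow> real" where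
  "bellman_H q z = - (q - 1) * z powr q + q * z powr (q - 1)"

definition omega :: "real \<Rightarrow> real \<Rightarrow> real" where
  "omega q = the_inv_into {1..conj_exp q} (bellman_H q)"

lemma bij_betw_bellman_H:
  assumes q: "1 < q"
  shows "bij_betw (bellman_H q) {1..conj_exp q} {0..1}"
proof -
  have c: "1 \<le> conj_exp q" using q by (simp add: conj_exp_def field_simps)
  have H1: "bellman_H q 1 = 1" by (simp add: bellman_H_def)
  have "conj_exp q powr q = conj_exp q powr (1 + (q - 1))" by simp
  also have "\<dots> = conj_exp q * conj_exp q powr (q - 1)"
    using c by (subst powr_add) simp
  finally have Hc: "bellman_H q (conj_exp q) = 0"
    using q by (simp add: bellman_H_def conj_exp_def divide_simps) (simp add: algebra_simps)
  have cont: "continuous_on {1..conj_exp q} (bellman_H q)"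
    unfolding bellman_H_def by (intro continuous_intros) auto
  have anti: "bellman_H q y < bellman_H q x" if "1 \<le> x" "x < y" for x y
  proof (rule DERIV_neg_imp_decreasing_open[OF that(2)])
    fix z assume z: "x < z" "z < y"
    have "((bellman_H q) has_real_derivative - (q - 1) * (q * z powr (q - 1)) + q * ((q - 1) * z powr (q - 1 - 1))) (at z)"
      unfolding bellman_H_def [abs_def] using that z by (auto intro!: derivative_eq_intros)
    moreover have "z powr (q - 2) < z powr (q - 1)" using that z by simp
    then have "q * (q - 1) * z powr (q - 2) < q * (q - 1) * z powr (q - 1)" using q by simp
    then have "- (q - 1) * (q * z powr (q - 1)) + q * ((q - 1) * z powr (q - 1 - 1)) < 0"
      by (simp add: algebra_simps)
    ultimately show "\<exists>d. (bellman_H q has_real_derivative d) (at z) \<and> d < 0" by blast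
  next
    show "continuous_on {x..y} (bellman_H q)"
      unfolding bellman_H_def using that by (intro continuous_intros) auto
  qed
  have inj: "inj_on (bellman_H q) {1..conj_exp q}"
    by (rule linorder_inj_onI') (use anti in fastforce)
  have le: "bellman_H q y \<le> bellman_H q x" if "1 \<le> x" "x \<le> y" for x y
    using anti[of x y] that by (cases "x = y") auto
  have "bellman_H q ` {1..conj_exp q} = {0..1}"
  proof (intro equalityI subsetI)
    fix y assume "y \<in> bellman_H q ` {1..conj_exp q}"
    then obtain x where x: "1 \<le> x" "x \<le> conj_exp q" "y = bellman_H q x" by auto
    then show "y \<in> {0..1}" using le[of 1 x] le[of x "conj_exp q"] H1 Hc by auto
  next
    fix y :: real assume "y \<in> {0..1}"
    then obtain x where "1 \<le> x" "x \<le> conj_exp q" "bellman_H q x = y"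
      using IVT2'[of "bellman_H q" "conj_exp q" y 1] H1 Hc c cont by auto
    then show "y \<in> bellman_H q ` {1..conj_exp q}" by auto
  qed
  with inj show ?thesis by (simp add: bij_betw_def)
qed

end

(*
  Upper bound. Stopping the descent in the tree at the first set with average above s gives
  s mu{M phi > s} <= int_{M phi > s} phi, so the rearrangement of M phi at t is at most the average
  Phi(t)/t of g = phi^* over (0,t]. Integrating the derivative of t^(q/p-q) Phi(t)^q and applying
  Young's inequality pointwise to (Phi/t)^(q-1) g bounds the weighted q-norm of Phi(t)/t by that of
  g and f; optimizing the parameter in Young's inequality produces the polynomial H_q.

  Lower bound. Equality in Young's inequality holds for g(t) = c t^(-alpha). Inside the tree one
  finds nested families, each of whose members is filled by the next family in a proportion close
  to r; a function with rearrangement g that concentrates along them has M phi nearly as large as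
  the average of g, and the deficit vanishes as r tends to 1.
*)
theory Submission
  imports Defs
begin

section \<open>One-dimensional integrals\<close>

text \<open>Both halves turn on one number x, the constant ratio of average to value of a power
  profile: for t^(-alpha) it is x = 1/(1 - alpha). Young's inequality is a tangent line inequality
  in u = g/(Phi/t), and touching at u = 1/x makes it sharp exactly for that profile. Substituting x
  = (p'/q') z turns the resulting expression into H_q(z), which is where the factor p'/q' comes
  from. A profile is non-increasing, so x >= 1. For p <= q this follows from z >= 1; for q < p it
  cuts off part of the range of z, and the domain condition with q/p says precisely that x >= 1. Two
  obstacles shape the details. The profile may be unbounded at 0 and have countably many jumps, so
  the derivative is integrated over [eps,1] off a countable set, and the boundary term is shown to
  vanish. In the tree, a family filling exactly a given proportion need not exist; the proportion is
  kept between r and r^theta. The error compounds over the generations into an error in the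
  exponent, alpha theta in place of alpha, which disappears as theta tends to 1 with r =
  theta.\<close>

lemma nn_integral_powr_0:
  fixes a c :: real
  assumes "-1 < a" "0 \<le> c"
  shows "(\<integral>\<^sup>+t\<in>{0<..c}. ennreal (t powr a) \<partial>lborel) = ennreal (c powr (a + 1) / (a + 1))"
proof -
  have "(\<integral>\<^sup>+t\<in>{0<..c}. ennreal (t powr a) \<partial>lborel) = (\<integral>\<^sup>+t\<in>{0..c}. ennreal (t powr a) \<partial>lborel)"
    by (intro nn_integral_cong) (auto simp: indicator_def)
  also have "\<dots> = ennreal (c powr (a + 1) / (a + 1))"
    using has_integral_powr_from_0[OF assms] by (intro nn_integral_has_integral_lebesgue') auto
  finally show ?thesis .
qed

text \<open>Needed because \<open>\<Phi>\<close> is known to be differentiable only off the jumps of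
  \<open>g\<close>. The idea is to pick a level that the tilted function takes at no exceptional
  point; the last point on that level is then one where the derivative exists.\<close>

lemma DERIV_nonpos_countable_imp_le:
  fixes D :: "real \<Rightarrow> real"
  assumes ab: "a < b" and cont: "continuous_on {a..b} D" and S: "countable S"
    and der: "\<And>t. a < t \<Longrightarrow> t < b \<Longrightarrow> t \<notin> S \<Longrightarrow> \<exists>d\<le>0. (D has_real_derivative d) (at t)"
  shows "D b \<le> D a"
proof (rule ccontr)
  assume "\<not> D b \<le> D a"
  \<comment> \<open>Half the slope of the chord: the tilt makes every available derivative of
    \<open>E\<close> strictly negative and still leaves \<open>E a < E b\<close>.\<close>
  define \<delta> where "\<delta> = (D b - D a) / (2 * (b - a))"
  have \<delta>: "0 < \<delta>" using ab \<open>\<not> D b \<le> D a\<close> by (simp add: \<delta>_def)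
  define E where "E t = D t - \<delta> * (t - a)" for t
  have contE: "continuous_on {a..b} E"
    unfolding E_def by (intro continuous_intros cont)
  have "\<delta> * (b - a) = (D b - D a) / 2"
    using ab unfolding \<delta>_def by (simp add: divide_simps)
  then have Eab: "E a < E b"
    using \<open>\<not> D b \<le> D a\<close> by (simp add: E_def)
  have "uncountable ({E a<..<E b} - E ` S)"
    using S Eab by (intro uncountable_minus_countable uncountable_open_interval[THEN iffD2]) auto
  then obtain y where y: "E a < y" "y < E b" "y \<notin> E ` S"
    by (metis DiffE countable_empty equals0I greaterThanLessThan_iff)
  define Z where "Z = {t\<in>{a..b}. E t \<le> y}"
  have "closed Z"
    unfolding Z_def by (intro continuous_on_closed_Collect_le contE continuous_on_const closed_atLeastAtMost)
  moreover have "a \<in> Z" using ab y by (auto simp: Z_def)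
  moreover have bdd: "bdd_above Z" by (auto simp: Z_def)
  ultimately have "Sup Z \<in> Z" by (intro closed_contains_Sup) auto
  \<comment> \<open>The last point where \<open>E\<close> is at most \<open>y\<close>. To its right
    \<open>E\<close> exceeds \<open>y\<close>, which will contradict the strict decrease just after
    \<open>s\<close>.\<close>
  define s where "s = Sup Z"
  have s: "a \<le> s" "s \<le> b" "E s \<le> y" using \<open>Sup Z \<in> Z\<close> by (auto simp: s_def Z_def)
  have above: "y < E t" if "s < t" "t \<le> b" for t
    using cSup_upper[OF _ bdd, of t] that s by (force simp: Z_def s_def)
  have sb: "s < b" using s y by (cases "s = b") auto
  have "E s = y"
  proof (rule ccontr)
    assume "E s \<noteq> y"
    with s have "E s < y" by simp
    moreover have "continuous_on {s..b} E" using contE s by (auto intro: continuous_on_subset)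
    ultimately obtain t where "s \<le> t" "t \<le> b" "E t = y"
      using IVT'[of E s y b] y s by auto
    with above[of t] \<open>E s < y\<close> show False by (cases "t = s") auto
  qed
  then have "s \<notin> S" "a < s" using y s by (auto simp: order.order_iff_strict)
  with der[of s] sb obtain d where d: "d \<le> 0" "(D has_real_derivative d) (at s)" by auto
  have "(E has_real_derivative d - \<delta>) (at s)"
    unfolding E_def [abs_def] by (auto intro!: derivative_eq_intros d)
  from DERIV_neg_dec_right[OF this] d \<delta>
  obtain e where e: "0 < e" "\<And>h. 0 < h \<Longrightarrow> h < e \<Longrightarrow> E (s + h) < E s" by auto
  have "E (s + min (e / 2) (b - s)) < E s" using e sb by (intro e(2)) auto
  moreover have "y < E (s + min (e / 2) (b - s))" using e sb by (intro above) auto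
  ultimately show False using \<open>E s = y\<close> by simp
qed

text \<open>Continuity from above of the measure with density \<open>h\<close>, applicable because
  of the finiteness hypothesis. It removes the boundary term at 0 in
  \<open>hardy_ineq\<close>.\<close>

lemma nn_integral_Ioc_shrink_tendsto_0:
  assumes [measurable]: "h \<in> borel_measurable borel"
    and fin: "(\<integral>\<^sup>+t\<in>{0<..1::real}. h t \<partial>lborel) < \<infinity>"
  shows "(\<lambda>n. \<integral>\<^sup>+t\<in>{0<..1 / real (Suc n)}. h t \<partial>lborel) \<longlonglongrightarrow> 0"
proof -
  let ?D = "density lborel h"
  have mono: "1 / real (Suc (Suc n)) \<le> 1 / real (Suc n)" "1 / real (Suc n) \<le> 1" for n
    by (simp_all add: divide_simps)
  have *: "emeasure ?D {0<..c} = (\<integral>\<^sup>+t\<in>{0<..c}. h t \<partial>lborel)" for c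
    by (simp add: emeasure_density)
  have "(\<lambda>n. emeasure ?D {0<..1 / real (Suc n)}) \<longlonglongrightarrow> emeasure ?D (\<Inter>n. {0<..1 / real (Suc n)})"
  proof (rule Lim_emeasure_decseq)
    show "decseq (\<lambda>n. {0<..1 / real (Suc n)})"
      by (intro decseq_SucI) (auto intro: order_trans[OF _ mono(1)] simp del: of_nat_Suc)
    have "emeasure ?D {0<..1 / real (Suc n)} \<le> emeasure ?D {0<..1}" for n
      by (intro emeasure_mono) (auto intro: order_trans[OF _ mono(2)] simp del: of_nat_Suc)
    then show "emeasure ?D {0<..1 / real (Suc n)} \<noteq> \<infinity>" for n
      using fin unfolding * by (metis infinity_ennreal_def le_less_trans less_irrefl)
  qed auto
  moreover have "(\<Inter>n. {0<..1 / real (Suc n)}) = {}"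
  proof -
    have "\<exists>n. 1 / real (Suc n) < x" if "0 < x" for x :: real
      using nat_approx_posE[OF that] by (metis inverse_eq_divide)
    then show ?thesis by (auto simp del: of_nat_Suc) (meson not_le)
  qed
  ultimately show ?thesis by (simp add: *)
qed

lemma nn_integral_Icc_exhaust_tendsto:
  assumes [measurable]: "h \<in> borel_measurable borel"
  shows "(\<lambda>n. \<integral>\<^sup>+t\<in>{1 / real (Suc n)..1}. h t \<partial>lborel) \<longlonglongrightarrow> (\<integral>\<^sup>+t\<in>{0<..1::real}. h t \<partial>lborel)"
proof -
  let ?D = "density lborel h"
  have mono: "1 / real (Suc (Suc n)) \<le> 1 / real (Suc n)" for n
    by (simp add: divide_simps)
  have "(\<lambda>n. emeasure ?D {1 / real (Suc n)..1}) \<longlonglongrightarrow> emeasure ?D (\<Union>n. {1 / real (Suc n)..1})"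
    by (rule Lim_emeasure_incseq) (auto intro!: incseq_SucI intro: order_trans[OF mono] simp del: of_nat_Suc)
  moreover have "(\<Union>n. {1 / real (Suc n)..1}) = {0<..1}"
  proof -
    have "\<exists>n. 1 / real (Suc n) \<le> x" if "0 < x" for x :: real
      using nat_approx_posE[OF that] by (metis inverse_eq_divide less_imp_le)
    then show ?thesis by (force intro: less_le_trans[rotated])
  qed
  ultimately show ?thesis by (simp add: emeasure_density)
qed

section \<open>Hardy-type inequalities for decreasing profiles\<close>

lemma bounded_measurable_integrable_on:
  fixes g :: "real \<Rightarrow> real"
  assumes [measurable]: "g \<in> borel_measurable borel"
    and nn: "\<And>t. a \<le> t \<Longrightarrow> t \<le> b \<Longrightarrow> 0 \<le> g t"
    and bd: "\<And>t. a \<le> t \<Longrightarrow> t \<le> b \<Longrightarrow> g t \<le> B"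
  shows "g integrable_on {a..b}"
proof -
  have "set_integrable lborel {a..b} g"
    unfolding set_integrable_def
    by (rule integrableI_bounded_set_indicator[where B=B]) (auto simp: nn bd emeasure_lborel_Icc_eq)
  then show ?thesis
    using set_borel_integral_eq_integral(1) by blast
qed

lemma has_real_derivative_integral:
  fixes h :: "real \<Rightarrow> real"
  assumes "h integrable_on {a..1}" "a < t" "t < 1" "isCont h t"
  shows "((\<lambda>u. integral {a..u} h) has_real_derivative h t) (at t)"
proof -
  have "((\<lambda>u. integral {a..u} h) has_vector_derivative h t) (at t within ({a..1} - {}))"
    using assms by (intro integral_has_vector_derivative_continuous_at) (auto intro: continuous_at_imp_continuous_at_within)
  then show ?thesis
    using assms by (simp add: has_real_derivative_iff_has_vector_derivative at_within_Icc_at)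
qed

text \<open>\<open>g\<close> stands for the rearrangement of the given function. It may blow up at
  0, so the order conditions are imposed on (0,1] only and the mass is a nonnegative
  integral.\<close>

locale decreasing_profile =
  fixes g :: "real \<Rightarrow> real" and f :: real
  assumes meas [measurable]: "g \<in> borel_measurable borel"
    and nn: "\<And>t. 0 < t \<Longrightarrow> t \<le> 1 \<Longrightarrow> 0 \<le> g t"
    and anti: "\<And>s t. 0 < s \<Longrightarrow> s \<le> t \<Longrightarrow> t \<le> 1 \<Longrightarrow> g t \<le> g s"
    and mass: "(\<integral>\<^sup>+t\<in>{0<..1}. ennreal (g t) \<partial>lborel) = ennreal f"
    and f_pos: "0 < f"
begin

definition \<Phi> :: "real \<Rightarrow> real" where
  "\<Phi> t = enn2real (\<integral>\<^sup>+s\<in>{0<..t}. ennreal (g s) \<partial>lborel)"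

lemma g_integrable_on: "0 < a \<Longrightarrow> b \<le> 1 \<Longrightarrow> g integrable_on {a..b}"
  by (rule bounded_measurable_integrable_on[where B="g a"]) (auto intro: nn anti)

lemma ennreal_\<Phi>: "t \<le> 1 \<Longrightarrow> ennreal (\<Phi> t) = (\<integral>\<^sup>+s\<in>{0<..t}. ennreal (g s) \<partial>lborel)"
proof -
  assume "t \<le> 1"
  then have "(\<integral>\<^sup>+s\<in>{0<..t}. ennreal (g s) \<partial>lborel) \<le> (\<integral>\<^sup>+s\<in>{0<..1}. ennreal (g s) \<partial>lborel)"
    by (intro nn_integral_mono) (auto simp: indicator_def)
  then show ?thesis
    unfolding \<Phi>_def mass by (intro ennreal_enn2real) (rule le_less_trans, assumption, simp)
qed

lemma \<Phi>_nonneg: "0 \<le> \<Phi> t"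
  by (simp add: \<Phi>_def)

lemma \<Phi>_1: "\<Phi> 1 = f"
  using f_pos by (simp add: \<Phi>_def mass)

text \<open>Away from 0 the profile is bounded, and this splitting makes the fundamental theorem for
  the gauge integral available for \<open>\<Phi>\<close>, which itself comes from the Lebesgue
  integral starting at 0.\<close>

lemma \<Phi>_eq:
  assumes "0 < a" "a \<le> t" "t \<le> 1"
  shows "\<Phi> t = \<Phi> a + integral {a..t} g"
proof -
  have "ennreal (\<Phi> t) = (\<integral>\<^sup>+s\<in>{0<..a} \<union> {a<..t}. ennreal (g s) \<partial>lborel)"
  proof -
    have "{0<..a} \<union> {a<..t} = {0<..t}" using assms by auto
    then show ?thesis using assms by (simp add: ennreal_\<Phi>)
  qed
  also have "\<dots> = (\<integral>\<^sup>+s\<in>{0<..a}. ennreal (g s) \<partial>lborel) + (\<integral>\<^sup>+s\<in>{a<..t}. ennreal (g s) \<partial>lborel)"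
    by (intro nn_integral_disjoint_pair) auto
  also have "(\<integral>\<^sup>+s\<in>{a<..t}. ennreal (g s) \<partial>lborel) = (\<integral>\<^sup>+s\<in>{a..t}. ennreal (g s) \<partial>lborel)"
    using AE_lborel_singleton[of a]
    by (intro nn_integral_cong_AE, eventually_elim) (auto simp: indicator_def)
  also have "\<dots> = ennreal (integral {a..t} g)"
    using assms by (intro nn_integral_has_integral_lebesgue' integrable_integral g_integrable_on nn) auto
  also have "(\<integral>\<^sup>+s\<in>{0<..a}. ennreal (g s) \<partial>lborel) = ennreal (\<Phi> a)"
    using assms by (simp add: ennreal_\<Phi>)
  finally have eq: "ennreal (\<Phi> t) = ennreal (\<Phi> a) + ennreal (integral {a..t} g)" .
  have "0 \<le> integral {a..t} g"
    using assms by (intro integral_nonneg g_integrable_on nn) auto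
  with eq show ?thesis
    by (simp add: \<Phi>_nonneg flip: ennreal_plus)
qed

lemma \<Phi>_ge: 
  assumes "0 < t" "t \<le> 1"
  shows "t * g t \<le> \<Phi> t"
proof -
  have "ennreal (t * g t) = (\<integral>\<^sup>+s\<in>{0<..t}. ennreal (g t) \<partial>lborel)"
    using assms nn[of t] by (simp add: nn_integral_cmult_indicator ennreal_mult mult.commute)
  also have "\<dots> \<le> ennreal (\<Phi> t)"
    using assms unfolding ennreal_\<Phi>[OF assms(2)]
    by (intro nn_integral_mono) (auto simp: indicator_def intro!: ennreal_leI anti)
  finally show ?thesis by (simp add: \<Phi>_nonneg)
qed

text \<open>Otherwise \<open>g\<close> would vanish at \<open>t\<close> and, by monotonicity, on
  [t,1], leaving total mass 0. Positivity is needed to divide by \<open>\<Phi> t\<close> and to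
  differentiate its powers.\<close>

lemma \<Phi>_pos:
  assumes "0 < t" "t \<le> 1"
  shows "0 < \<Phi> t"
proof (rule ccontr)
  assume "\<not> 0 < \<Phi> t"
  with \<Phi>_nonneg[of t] have "\<Phi> t = 0" by simp
  with \<Phi>_ge[OF assms] assms nn[of t] have "g t = 0"
    by (simp add: mult_le_0_iff)
  then have "integral {t..1} g = integral {t..1} (\<lambda>_. 0)"
    using anti[of t] nn assms by (intro integral_cong) (auto intro!: antisym)
  with \<Phi>_eq[of t 1] assms \<open>\<Phi> t = 0\<close> f_pos \<Phi>_1 show False by simp
qed

lemma \<Phi>_continuous_on: "0 < a \<Longrightarrow> continuous_on {a..1} \<Phi>"
proof -
  assume a: "0 < a"
  then have "continuous_on {a..1} (\<lambda>t. \<Phi> a + integral {a..t} g)"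
    by (intro continuous_intros indefinite_integral_continuous_1 g_integrable_on) auto
  then show ?thesis
    by (rule continuous_on_cong[THEN iffD1, rotated 2]) (use a in \<open>auto simp: \<Phi>_eq[symmetric]\<close>)
qed

lemma \<Phi>_meas [measurable]: "\<Phi> \<in> borel_measurable borel"
proof -
  \<comment> \<open>The indicator becomes a condition on the pair (s,t), since measurability in the
    parameter \<open>t\<close> calls for a jointly measurable integrand.\<close>
  have "\<Phi> = (\<lambda>t. enn2real (\<integral>\<^sup>+s. ennreal (g s) * (if 0 < s \<and> s \<le> t then 1 else 0) \<partial>lborel))"
    unfolding \<Phi>_def by (intro ext arg_cong[where f=enn2real] nn_integral_cong) (auto simp: indicator_def)
  also have "\<dots> \<in> borel_measurable borel"
    by measurable
  finally show ?thesis .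
qed

lemma countable_discont: "countable {t\<in>{0<..<1}. \<not> isCont g t}"
proof -
  have "countable {t\<in>{0<..<1}. \<not> isCont (\<lambda>t. - g t) t}"
    by (intro mono_on_ctble_discont_open) (auto intro!: mono_onI anti)
  moreover have "isCont (\<lambda>t. - g t) t \<longleftrightarrow> isCont g t" for t
    using continuous_minus[of "at t" g] continuous_minus[of "at t" "\<lambda>t. - g t"] by auto
  ultimately show ?thesis by simp
qed


text \<open>Controls the boundary term at \<epsilon> by the part \<open>E\<close> of the Lorentz
  integral over (0,\<epsilon>], which tends to 0. Monotonicity turns the integral bound into the
  pointwise bound \<open>g t \<le> C * t powr (- (1 / p))\<close>; integrating it bounds
  \<open>\<Phi> \<epsilon>\<close>, with convergence at 0 because \<open>p > 1\<close>.\<close>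

lemma powr_\<Phi>_bound:
  assumes "1 < p" "1 < q" "0 < \<epsilon>" "\<epsilon> \<le> 1"
    and fin: "(\<integral>\<^sup>+t\<in>{0<..\<epsilon>}. ennreal (t powr (q / p - 1) * g t powr q) \<partial>lborel) = ennreal E" and "0 \<le> E"
  shows "\<epsilon> powr (q / p - q) * \<Phi> \<epsilon> powr q \<le> q / p * conj_exp p powr q * E"
proof -
  define C where "C = (q / p * E) powr (1 / q)"
  have C: "0 \<le> C" "C powr q = q / p * E"
    using assms by (auto simp: C_def powr_powr)
  have g: "g t \<le> C * t powr (- (1 / p))" if t: "0 < t" "t \<le> \<epsilon>" for t
  proof -
    have "ennreal (p / q * t powr (q / p) * g t powr q) =
        (\<integral>\<^sup>+s\<in>{0<..t}. ennreal (s powr (q / p - 1)) * ennreal (g t powr q) \<partial>lborel)"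
    proof -
      have "(\<integral>\<^sup>+s\<in>{0<..t}. ennreal (s powr (q / p - 1)) * ennreal (g t powr q) \<partial>lborel) =
         (\<integral>\<^sup>+s. ennreal (g t powr q) * (ennreal (s powr (q / p - 1)) * indicator {0<..t} s) \<partial>lborel)"
        by (intro nn_integral_cong) (simp add: mult_ac)
      also have "\<dots> = ennreal (g t powr q) * ennreal (t powr (q / p - 1 + 1) / (q / p - 1 + 1))"
        using assms t by (simp add: nn_integral_cmult nn_integral_powr_0)
      also have "\<dots> = ennreal (p / q * t powr (q / p) * g t powr q)"
        using assms by (simp add: ennreal_mult'[symmetric] mult_ac)
      finally show ?thesis by simp
    qed
    also have "\<dots> \<le> (\<integral>\<^sup>+t\<in>{0<..\<epsilon>}. ennreal (t powr (q / p - 1) * g t powr q) \<partial>lborel)"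
      using assms t nn[of t]
      by (intro nn_integral_mono)
        (auto simp: indicator_def ennreal_mult'[symmetric] intro!: ennreal_leI mult_left_mono powr_mono2 anti)
    finally have "p / q * t powr (q / p) * g t powr q \<le> E"
      using assms by (simp add: fin)
    then have "t powr (q / p) * g t powr q \<le> q / p * E"
      using assms by (simp add: field_simps)
    then have "(t powr (q / p) * g t powr q) powr (1 / q) \<le> C"
      unfolding C_def using assms by (intro powr_mono2) auto
    also have "(t powr (q / p) * g t powr q) powr (1 / q) = t powr (1 / p) * g t"
      using assms t nn[of t] by (simp add: powr_mult powr_powr)
    finally show ?thesis
      using t by (simp add: powr_minus field_simps)
  qed
  have "ennreal (\<Phi> \<epsilon>) \<le> (\<integral>\<^sup>+s\<in>{0<..\<epsilon>}. ennreal (C * s powr (- (1 / p))) \<partial>lborel)"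
    unfolding ennreal_\<Phi>[OF assms(4)] by (intro nn_integral_mono) (auto simp: indicator_def intro!: ennreal_leI g)
  also have "\<dots> = (\<integral>\<^sup>+s. ennreal C * (ennreal (s powr (- (1 / p))) * indicator {0<..\<epsilon>} s) \<partial>lborel)"
    using C by (intro nn_integral_cong) (simp add: ennreal_mult mult_ac)
  also have "\<dots> = ennreal C * ennreal (\<epsilon> powr (1 - 1 / p) / (1 - 1 / p))"
    using assms by (simp add: nn_integral_cmult nn_integral_powr_0)
  also have "\<dots> = ennreal (C * (conj_exp p * \<epsilon> powr (1 - 1 / p)))"
  proof -
    have "x / (1 - 1 / p) = conj_exp p * x" for x
      using assms by (simp add: conj_exp_def field_simps)
    then show ?thesis using C by (simp add: ennreal_mult'[symmetric])
  qed
  finally have "\<Phi> \<epsilon> \<le> C * (conj_exp p * \<epsilon> powr (1 - 1 / p))"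
    using C assms by (subst (asm) ennreal_le_iff) (auto simp: conj_exp_def)
  then have "\<Phi> \<epsilon> powr q \<le> (C * (conj_exp p * \<epsilon> powr (1 - 1 / p))) powr q"
    using assms by (intro powr_mono2) (auto simp: \<Phi>_nonneg)
  also have "\<dots> = q / p * E * (conj_exp p powr q * \<epsilon> powr (q - q / p))"
  proof -
    have "0 \<le> conj_exp p" "(1 - 1 / p) * q = q - q / p"
      using assms by (simp_all add: conj_exp_def algebra_simps)
    then show ?thesis using C by (simp add: powr_mult powr_powr)
  qed
  finally have "\<epsilon> powr (q / p - q) * \<Phi> \<epsilon> powr q \<le> \<epsilon> powr (q / p - q) * (q / p * E * (conj_exp p powr q * \<epsilon> powr (q - q / p)))"
    by (intro mult_left_mono) auto
  also have "\<dots> = (\<epsilon> powr (q / p - q) * \<epsilon> powr (q - q / p)) * (q / p * conj_exp p powr q * E)"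
    by (simp add: mult_ac)
  also have "\<epsilon> powr (q / p - q) * \<epsilon> powr (q - q / p) = 1"
    using assms by (simp add: powr_add[symmetric])
  finally show ?thesis by simp
qed

text \<open>
  Integration by parts for \<open>t powr (q/p - q) * \<Phi> t powr q\<close>, whose derivative is
  \<open>t powr (q/p - 1) * (\<Phi> t / t) powr q * (q u - q (1 - 1/p))\<close> with \<open>u = g t / (\<Phi> t / t) \<in> [0,1]\<close>; a
  pointwise inequality in \<open>u\<close> therefore integrates to an inequality of Hardy type.
\<close>

lemma hardy_derivative:
  assumes "1 < p" "1 < q" "0 \<le> a" "0 \<le> b"
    and ptw: "\<And>u. 0 \<le> u \<Longrightarrow> u \<le> 1 \<Longrightarrow> q * u - q * (1 - 1 / p) + a \<le> b * u powr q"
    and t: "0 < t" "t < 1"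
    and \<Phi>': "(\<Phi> has_real_derivative g t) (at t)"
  shows "\<exists>d. ((\<lambda>t. t powr (q / p - q) * \<Phi> t powr q) has_real_derivative d) (at t) \<and>
    d \<le> b * (t powr (q / p - 1) * g t powr q) - a * (t powr (q / p - 1) * (\<Phi> t / t) powr q)"
proof -
  have pos: "0 < \<Phi> t" using t by (intro \<Phi>_pos) auto
  define u where "u = t * g t / \<Phi> t"
  have u: "0 \<le> u" "u \<le> 1"
    using t pos nn[of t] \<Phi>_ge[of t] by (auto simp: u_def)
  have gt: "g t = u * (\<Phi> t / t)" using t pos by (simp add: u_def)
  define W where "W = t powr (q / p - 1) * (\<Phi> t / t) powr q"
  have der: "((\<lambda>t. t powr (q / p - q) * \<Phi> t powr q) has_real_derivative
     (q / p - q) * t powr (q / p - q - 1) * \<Phi> t powr q + t powr (q / p - q) * (q * \<Phi> t powr (q - 1) * g t)) (at t)"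
    using DERIV_mult[OF has_real_derivative_powr[OF t(1), of "q / p - q"] DERIV_fun_powr[OF \<Phi>' pos, of q]]
    by (simp add: ac_simps)
  have d1: "(q / p - q) * t powr (q / p - q - 1) * \<Phi> t powr q = W * (q / p - q)"
  proof -
    have "t powr (q / p - q - 1) = t powr (q / p - 1) / t powr q"
      using t by (simp add: powr_diff)
    then show ?thesis using t pos by (simp add: W_def powr_divide)
  qed
  have d2: "t powr (q / p - q) * (q * \<Phi> t powr (q - 1) * g t) = W * (q * u)"
  proof -
    have 1: "t powr (q / p - q) / t = t powr (q / p - 1) / t powr q"
      using t by (simp add: powr_diff)
    have 2: "\<Phi> t powr (q - 1) * \<Phi> t = \<Phi> t powr q"
      using pos by (simp add: powr_diff)
    have "t powr (q / p - q) * (q * \<Phi> t powr (q - 1) * g t) =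
        (t powr (q / p - q) / t) * (\<Phi> t powr (q - 1) * \<Phi> t) * (q * u)"
    proof -
      have "A * (q * X * (u * (Y / t))) = (A / t) * (X * Y) * (q * u)" for A X Y :: real
        by simp
      then show ?thesis unfolding gt .
    qed
    also have "\<dots> = W * (q * u)"
      unfolding 1 2 using t pos by (simp add: W_def powr_divide)
    finally show ?thesis .
  qed
  have "W * (q * u - q * (1 - 1 / p) + a) \<le> W * (b * u powr q)"
    by (intro mult_left_mono ptw u) (auto simp: W_def)
  then have le: "W * (q / p - q) + W * (q * u) \<le> b * (W * u powr q) - a * W"
    by (simp add: algebra_simps)
  have "g t powr q = u powr q * (\<Phi> t / t) powr q"
    using t pos u by (subst gt, subst powr_mult) auto
  then have g: "W * u powr q = t powr (q / p - 1) * g t powr q"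
    by (simp add: W_def)
  show ?thesis
  proof (intro exI[of _ "W * (q / p - q) + W * (q * u)"] conjI)
    show "((\<lambda>t. t powr (q / p - q) * \<Phi> t powr q) has_real_derivative W * (q / p - q) + W * (q * u)) (at t)"
      using der unfolding d1 d2 .
    show "W * (q / p - q) + W * (q * u)
        \<le> b * (t powr (q / p - 1) * g t powr q) - a * (t powr (q / p - 1) * (\<Phi> t / t) powr q)"
      using le[unfolded g] by (simp only: W_def)
  qed
qed

text \<open>The integration starts at \<epsilon> because the integrands can be unbounded at 0.
  \<open>D\<close> collects the two sides as functions of the upper limit; its derivative is
  nonpositive wherever \<open>g\<close> is continuous, and \<open>D 1 \<le> D \<epsilon>\<close> is
  the claim.\<close>

lemma hardy_truncated:
  assumes "1 < p" "1 < q" "0 \<le> a" "0 \<le> b"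
    and ptw: "\<And>u. 0 \<le> u \<Longrightarrow> u \<le> 1 \<Longrightarrow> q * u - q * (1 - 1 / p) + a \<le> b * u powr q"
    and \<epsilon>: "0 < \<epsilon>" "\<epsilon> < 1"
  shows "ennreal (f powr q) + ennreal a * (\<integral>\<^sup>+t\<in>{\<epsilon>..1}. ennreal (t powr (q / p - 1) * (\<Phi> t / t) powr q) \<partial>lborel)
    \<le> ennreal b * (\<integral>\<^sup>+t\<in>{\<epsilon>..1}. ennreal (t powr (q / p - 1) * g t powr q) \<partial>lborel)
      + ennreal (\<epsilon> powr (q / p - q) * \<Phi> \<epsilon> powr q)"
proof -
  define H where "H t = t powr (q / p - q) * \<Phi> t powr q" for t
  define P where "P t = t powr (q / p - 1) * g t powr q" for t
  define N where "N t = t powr (q / p - 1) * (\<Phi> t / t) powr q" for t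
  \<comment> \<open>The exponent \<open>q / p - 1\<close> can have either sign, so the maximum may
    sit at either end of the interval.\<close>
  have tpow: "t powr (q / p - 1) \<le> max 1 (\<epsilon> powr (q / p - 1))" if "\<epsilon> \<le> t" "t \<le> 1" for t
  proof (cases "q / p \<ge> 1")
    case True
    then have "t powr (q / p - 1) \<le> 1 powr (q / p - 1)" using that \<epsilon> by (intro powr_mono2) auto
    then show ?thesis by simp
  next
    case False
    then have "t powr (q / p - 1) \<le> \<epsilon> powr (q / p - 1)" using that \<epsilon> by (intro powr_mono2') auto
    then show ?thesis by simp
  qed
  have P: "P integrable_on {\<epsilon>..1}"
  proof (rule bounded_measurable_integrable_on[where B="max 1 (\<epsilon> powr (q / p - 1)) * g \<epsilon> powr q"])
    fix t assume t: "\<epsilon> \<le> t" "t \<le> 1"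
    then have "0 \<le> g t" "g t \<le> g \<epsilon>" using \<epsilon> by (auto intro: nn anti)
    then have "g t powr q \<le> g \<epsilon> powr q" using assms by (intro powr_mono2) auto
    then show "P t \<le> max 1 (\<epsilon> powr (q / p - 1)) * g \<epsilon> powr q"
      unfolding P_def by (intro mult_mono tpow t) auto
  qed (simp_all add: P_def [abs_def])
  have contN: "continuous_on {\<epsilon>..1} N"
  proof -
    have "t \<noteq> 0" "\<Phi> t / t \<noteq> 0" if "t \<in> {\<epsilon>..1}" for t
      using \<Phi>_pos[of t] \<epsilon> that by auto
    then show ?thesis
      unfolding N_def using \<epsilon> by (intro continuous_intros \<Phi>_continuous_on) auto
  qed
  then have N: "N integrable_on {\<epsilon>..1}"
    by (rule integrable_continuous_interval)
  define D where "D t = H t - (b * integral {\<epsilon>..t} P - a * integral {\<epsilon>..t} N)" for t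
  have "D 1 \<le> D \<epsilon>"
  proof (rule DERIV_nonpos_countable_imp_le[OF \<epsilon>(2) _ countable_discont])
    show "continuous_on {\<epsilon>..1} D"
    proof -
      have "t \<noteq> 0" "\<Phi> t \<noteq> 0" if "t \<in> {\<epsilon>..1}" for t
        using \<Phi>_pos[of t] \<epsilon> that by auto
      then show ?thesis
        unfolding D_def H_def using \<epsilon>
        by (intro continuous_intros \<Phi>_continuous_on indefinite_integral_continuous_1 P N) auto
    qed
    fix t assume t: "\<epsilon> < t" "t < 1" "t \<notin> {t \<in> {0<..<1}. \<not> isCont g t}"
    with \<epsilon> have g: "isCont g t" by auto
    have "((\<lambda>t. \<Phi> \<epsilon> + integral {\<epsilon>..t} g) has_real_derivative 0 + g t) (at t)"
      using t \<epsilon> g by (intro DERIV_add DERIV_const has_real_derivative_integral g_integrable_on) auto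
    moreover have "eventually (\<lambda>s. s \<in> {\<epsilon><..<1}) (nhds t)"
      using t by (intro eventually_nhds_in_open) auto
    then have "eventually (\<lambda>s. \<Phi> \<epsilon> + integral {\<epsilon>..s} g = \<Phi> s) (nhds t)"
      by eventually_elim (use \<epsilon> in \<open>auto intro!: \<Phi>_eq[of \<epsilon>, symmetric]\<close>)
    ultimately have \<Phi>': "(\<Phi> has_real_derivative g t) (at t)"
      using DERIV_cong_ev[OF refl, of "\<lambda>t. \<Phi> \<epsilon> + integral {\<epsilon>..t} g" \<Phi> t "g t" "g t"] by simp
    obtain d where d: "(H has_real_derivative d) (at t)" "d \<le> b * P t - a * N t"
      using hardy_derivative[OF assms(1-4) ptw _ _ \<Phi>'] t \<epsilon> unfolding H_def[abs_def] P_def N_def by auto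
    \<comment> \<open>\<open>g t\<close> may be 0, and the limit rule for powers then asks for a
      nonnegative base near \<open>t\<close>.\<close>
    have cP: "isCont P t"
    proof -
      have "eventually (\<lambda>s. s \<in> {0<..<1}) (at t)"
        using t \<epsilon> by (intro eventually_at_in_open') auto
      then have "eventually (\<lambda>s. 0 \<le> g s) (at t)"
        by eventually_elim (auto intro: nn)
      then have "((\<lambda>s. g s powr q) \<longlongrightarrow> g t powr q) (at t)"
        using assms g[unfolded isCont_def] by (intro tendsto_powr') auto
      moreover have "isCont (\<lambda>s. s powr (q / p - 1)) t"
        using t \<epsilon> by (intro DERIV_isCont[OF has_real_derivative_powr]) auto
      ultimately show ?thesis
        unfolding P_def [abs_def] isCont_def by (intro tendsto_mult)
    qed
    have cN: "isCont N t"
      using continuous_on_interior[OF contN, of t] t by (simp add: interior_atLeastAtMost_real)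
    have "(D has_real_derivative d - (b * P t - a * N t)) (at t)"
      unfolding D_def
      by (intro DERIV_diff DERIV_cmult d has_real_derivative_integral P N t cP cN)
    with d(2) show "\<exists>d\<le>0. (D has_real_derivative d) (at t)"
      by (intro exI[of _ "d - (b * P t - a * N t)"]) auto
  qed
  then have "f powr q + a * integral {\<epsilon>..1} N \<le> b * integral {\<epsilon>..1} P + H \<epsilon>"
    by (simp add: D_def H_def \<Phi>_1 algebra_simps)
  moreover have "0 \<le> integral {\<epsilon>..1} N" "0 \<le> integral {\<epsilon>..1} P"
    using \<epsilon> by (auto intro!: integral_nonneg N P simp: N_def P_def)
  moreover have "(\<integral>\<^sup>+t\<in>{\<epsilon>..1}. ennreal (N t) \<partial>lborel) = ennreal (integral {\<epsilon>..1} N)"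
    by (intro nn_integral_has_integral_lebesgue' integrable_integral N) (auto simp: N_def)
  moreover have "(\<integral>\<^sup>+t\<in>{\<epsilon>..1}. ennreal (P t) \<partial>lborel) = ennreal (integral {\<epsilon>..1} P)"
    by (intro nn_integral_has_integral_lebesgue' integrable_integral P) (auto simp: P_def)
  ultimately show ?thesis
    using assms
    by (simp add: N_def[symmetric] P_def[symmetric] H_def[symmetric] flip: ennreal_mult ennreal_plus)
      (simp add: H_def flip: ennreal_mult ennreal_plus)
qed

lemma hardy_ineq:
  assumes "1 < p" "1 < q" "0 \<le> a" "0 \<le> b"
    and ptw: "\<And>u. 0 \<le> u \<Longrightarrow> u \<le> 1 \<Longrightarrow> q * u - q * (1 - 1 / p) + a \<le> b * u powr q"
    and fin: "(\<integral>\<^sup>+t\<in>{0<..1}. ennreal (t powr (q / p - 1) * g t powr q) \<partial>lborel) = ennreal F"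
  shows "ennreal (f powr q) + ennreal a * (\<integral>\<^sup>+t\<in>{0<..1}. ennreal (t powr (q / p - 1) * (\<Phi> t / t) powr q) \<partial>lborel)
    \<le> ennreal b * ennreal F"
proof -
  \<comment> \<open>The shift by two keeps \<open>e n < 1\<close> for every \<open>n\<close>, as
    \<open>hardy_truncated\<close> requires.\<close>
  define e where "e n = 1 / real (Suc (Suc n))" for n
  have e: "0 < e n" "e n < 1" for n by (auto simp: e_def divide_simps)
  define h where "h t = t powr (q / p - 1) * g t powr q" for t
  define R where "R n = enn2real (\<integral>\<^sup>+t\<in>{0<..e n}. ennreal (h t) \<partial>lborel)" for n
  have le: "(\<integral>\<^sup>+t\<in>A. ennreal (h t) \<partial>lborel) \<le> ennreal F" if "A \<subseteq> {0<..1}" for A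
    unfolding fin[symmetric] h_def by (intro nn_integral_mono) (use that in \<open>auto simp: indicator_def\<close>)
  have R: "(\<integral>\<^sup>+t\<in>{0<..e n}. ennreal (h t) \<partial>lborel) = ennreal (R n)" for n
  proof -
    have "(\<integral>\<^sup>+t\<in>{0<..e n}. ennreal (h t) \<partial>lborel) \<le> ennreal F"
      using e[of n] by (intro le) auto
    then have "(\<integral>\<^sup>+t\<in>{0<..e n}. ennreal (h t) \<partial>lborel) < top"
      by (rule le_less_trans) simp
    then show ?thesis by (simp add: R_def)
  qed
  have R0: "0 \<le> R n" for n by (simp add: R_def)
  have R_lim: "(\<lambda>n. ennreal (q / p * conj_exp p powr q) * ennreal (R n)) \<longlonglongrightarrow> ennreal (q / p * conj_exp p powr q) * 0"
    unfolding R[symmetric] unfolding e_def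
    by (intro ennreal_tendsto_cmult LIMSEQ_Suc[OF nn_integral_Ioc_shrink_tendsto_0])
      (auto simp: h_def fin)
  show ?thesis
  proof (rule LIMSEQ_le)
    show "(\<lambda>n. ennreal (f powr q) + ennreal a * (\<integral>\<^sup>+t\<in>{e n..1}. ennreal (t powr (q / p - 1) * (\<Phi> t / t) powr q) \<partial>lborel))
      \<longlonglongrightarrow> ennreal (f powr q) + ennreal a * (\<integral>\<^sup>+t\<in>{0<..1}. ennreal (t powr (q / p - 1) * (\<Phi> t / t) powr q) \<partial>lborel)"
      unfolding e_def
      by (intro tendsto_add tendsto_const ennreal_tendsto_cmult LIMSEQ_Suc[OF nn_integral_Icc_exhaust_tendsto]) auto
    show "(\<lambda>n. ennreal b * ennreal F + ennreal (q / p * conj_exp p powr q) * ennreal (R n)) \<longlonglongrightarrow> ennreal b * ennreal F"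
      using tendsto_add[OF tendsto_const R_lim] by simp
    have "ennreal (f powr q) + ennreal a * (\<integral>\<^sup>+t\<in>{e n..1}. ennreal (t powr (q / p - 1) * (\<Phi> t / t) powr q) \<partial>lborel)
      \<le> ennreal b * ennreal F + ennreal (q / p * conj_exp p powr q) * ennreal (R n)" for n
    proof -
      have "ennreal (f powr q) + ennreal a * (\<integral>\<^sup>+t\<in>{e n..1}. ennreal (t powr (q / p - 1) * (\<Phi> t / t) powr q) \<partial>lborel)
        \<le> ennreal b * (\<integral>\<^sup>+t\<in>{e n..1}. ennreal (h t) \<partial>lborel) + ennreal (e n powr (q / p - q) * \<Phi> (e n) powr q)"
        unfolding h_def by (rule hardy_truncated[OF assms(1-4) ptw e])
      also have "\<dots> \<le> ennreal b * ennreal F + ennreal (q / p * conj_exp p powr q * R n)"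
        using e[of n] by (intro add_mono mult_left_mono le ennreal_leI powr_\<Phi>_bound assms(1,2) R0 R[unfolded h_def]) auto
      also have "ennreal (q / p * conj_exp p powr q * R n) = ennreal (q / p * conj_exp p powr q) * ennreal (R n)"
        using assms by (intro ennreal_mult R0) auto
      finally show ?thesis .
    qed
    then show "\<exists>N. \<forall>n\<ge>N. ennreal (f powr q) + ennreal a * (\<integral>\<^sup>+t\<in>{e n..1}. ennreal (t powr (q / p - 1) * (\<Phi> t / t) powr q) \<partial>lborel)
      \<le> ennreal b * ennreal F + ennreal (q / p * conj_exp p powr q) * ennreal (R n)" by blast
  qed
qed

end

text \<open>The tangent at \<open>u = y\<close> to the convex function
  \<open>y powr (1 - q) * u powr q\<close>, so equality holds there.
  \<open>weighted_average_le\<close> takes \<open>y = 1 / x\<close>, the value of \<open>u\<close>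
  for a power profile whose averages are \<open>x\<close> times its values.\<close>

lemma young_power:
  fixes q u y :: real
  assumes "1 < q" "0 \<le> u" "0 < y"
  shows "q * u \<le> (q - 1) * y + y powr (1 - q) * u powr q"
proof (cases "u = 0")
  case False
  have "(u powr q * y powr (1 - q)) powr (1 / q) * y powr ((q - 1) / q)
      \<le> (1 / q) * (u powr q * y powr (1 - q)) + ((q - 1) / q) * y"
    using assms False by (intro Youngs_inequality_0) (auto simp: field_simps)
  also have "(u powr q * y powr (1 - q)) powr (1 / q) * y powr ((q - 1) / q) = u"
    using assms False by (simp add: powr_mult powr_powr powr_add[symmetric] diff_divide_distrib)
  finally have "q * u \<le> q * ((1 / q) * (u powr q * y powr (1 - q)) + ((q - 1) / q) * y)"
    using assms by (intro mult_left_mono) auto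
  then show ?thesis using assms by (simp add: distrib_left mult.commute add.commute)
qed (use assms in auto)

text \<open>With \<open>a = 0\<close> the tangency point of Young's inequality would be q'/p', which
  exceeds 1 when \<open>q < p\<close>. On [0,1] the constant is then decided by the endpoint
  \<open>u = 1\<close>, where equality holds here.\<close>

lemma bernoulli_power:
  fixes p q u :: real
  assumes "1 < q" "q < p" "0 \<le> u" "u \<le> 1"
  shows "q * u - q * (1 - 1 / p) \<le> q / p * u powr q"
proof -
  have "(q / p) * (q * u) \<le> (q / p) * ((q - 1) + u powr q)"
    using young_power[of q u 1] assms by (intro mult_left_mono) auto
  moreover have "q * q / p * (1 - u) \<le> q * (1 - u)"
    using assms by (intro mult_right_mono) (auto simp: field_simps)
  ultimately show ?thesis using assms by (simp add: algebra_simps diff_divide_distrib)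
qed

section \<open>Sharp bounds for a decreasing profile\<close>

context decreasing_profile
begin

text \<open>The q-th power of the Lorentz quasinorm of the running average
  \<open>\<Phi> t / t\<close>, which dominates the rearranged maximal function.\<close>

definition weighted_average :: "real \<Rightarrow> real \<Rightarrow> ennreal" where
  "weighted_average p q = (\<integral>\<^sup>+t\<in>{0<..1}. ennreal (t powr (q / p - 1) * (\<Phi> t / t) powr q) \<partial>lborel)"

text \<open>The upper limit on \<open>y\<close> says exactly that the coefficient of the average is
  nonnegative.\<close>

lemma hardy_young:
  assumes pq: "1 < p" "1 < q" and y: "0 < y" "y \<le> conj_exp q / conj_exp p"
    and fin: "(\<integral>\<^sup>+t\<in>{0<..1}. ennreal (t powr (q / p - 1) * g t powr q) \<partial>lborel) = ennreal F"
  shows "ennreal (f powr q) + ennreal (q * (1 - 1 / p) - (q - 1) * y) * weighted_average p q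
    \<le> ennreal (y powr (1 - q)) * ennreal F"
  unfolding weighted_average_def
proof (rule hardy_ineq[OF pq _ _ _ fin])
  have "(q - 1) * y \<le> (q - 1) * (conj_exp q / conj_exp p)"
    using pq y by (intro mult_left_mono) auto
  also have "\<dots> = q * (1 - 1 / p)"
    using pq by (simp add: conj_exp_def field_simps)
  finally show "0 \<le> q * (1 - 1 / p) - (q - 1) * y" by simp
  show "q * u - q * (1 - 1 / p) + (q * (1 - 1 / p) - (q - 1) * y) \<le> y powr (1 - q) * u powr q"
    if "0 \<le> u" "u \<le> 1" for u
    using young_power[of q u y] pq y that by simp
qed simp

text \<open>The largest \<open>y\<close> allowed in \<open>hardy_young\<close> makes the coefficient
  of the average vanish and the right side smallest.\<close>

lemma mass_power_le:
  assumes pq: "1 < p" "1 < q" and F: "0 \<le> F"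
    and fin: "(\<integral>\<^sup>+t\<in>{0<..1}. ennreal (t powr (q / p - 1) * g t powr q) \<partial>lborel) = ennreal F"
  shows "f powr q \<le> (conj_exp p / conj_exp q) powr (q - 1) * F"
proof -
  have c: "0 < conj_exp q / conj_exp p" using pq by (simp add: conj_exp_def)
  have "ennreal (f powr q) \<le> ennreal ((conj_exp q / conj_exp p) powr (1 - q)) * ennreal F"
    using hardy_young[OF pq c order_refl fin] by (rule order_trans[rotated]) simp
  then have "f powr q \<le> (conj_exp q / conj_exp p) powr (1 - q) * F"
    using F by (simp add: ennreal_mult'[symmetric])
  also have "(conj_exp q / conj_exp p) powr (1 - q) = (conj_exp p / conj_exp q) powr (q - 1)"
    using pq by (simp add: conj_exp_def powr_divide powr_minus_divide[of _ "q - 1", simplified] mult.commute)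
  finally show ?thesis .
qed

lemma mass_power_le':
  assumes pq: "1 < q" "q < p" and F: "0 \<le> F"
    and fin: "(\<integral>\<^sup>+t\<in>{0<..1}. ennreal (t powr (q / p - 1) * g t powr q) \<partial>lborel) = ennreal F"
  shows "f powr q \<le> q / p * F"
proof -
  have "ennreal (f powr q) + ennreal 0 * (\<integral>\<^sup>+t\<in>{0<..1}. ennreal (t powr (q / p - 1) * (\<Phi> t / t) powr q) \<partial>lborel)
     \<le> ennreal (q / p) * ennreal F"
    using pq bernoulli_power[of q p] by (intro hardy_ineq fin) auto
  then have "ennreal (f powr q) \<le> ennreal (q / p * F)"
    using pq F by (simp add: ennreal_mult'[symmetric])
  then show ?thesis
    using pq F by (subst (asm) ennreal_le_iff) auto
qed

text \<open>Young's inequality with \<open>y = 1 / x\<close> leaves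
  \<open>a * A \<le> x powr (q - 1) * F - f powr q\<close>, and the hypothesis on \<open>f\<close>
  is chosen so that the right side is at most \<open>a * (x powr q * F)\<close>. The strict bound on
  \<open>x\<close> gives \<open>a > 0\<close>, needed to divide.\<close>

lemma weighted_average_le:
  assumes pq: "1 < p" "1 < q" and F: "0 \<le> F" and x: "conj_exp p / conj_exp q < x"
    and fin: "(\<integral>\<^sup>+t\<in>{0<..1}. ennreal (t powr (q / p - 1) * g t powr q) \<partial>lborel) = ennreal F"
    and f: "F * (q * x powr (q - 1) - q * (1 - 1 / p) * x powr q) \<le> f powr q"
  shows "weighted_average p q \<le> ennreal (x powr q * F)"
proof -
  have "0 < conj_exp p / conj_exp q" using pq by (simp add: conj_exp_def)
  with x have x0: "0 < x" by linarith
  define a where "a = q * (1 - 1 / p) - (q - 1) / x"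
  have "(q - 1) / x < (q - 1) / (conj_exp p / conj_exp q)"
    using pq x \<open>0 < conj_exp p / conj_exp q\<close> by (intro divide_strict_left_mono mult_pos_pos x0) auto
  also have "\<dots> = q * (1 - 1 / p)"
    using pq by (simp add: conj_exp_def field_simps)
  finally have a: "0 < a" by (simp add: a_def)
  have "1 / x \<le> 1 / (conj_exp p / conj_exp q)"
    using x \<open>0 < conj_exp p / conj_exp q\<close> x0 by (intro divide_left_mono mult_pos_pos) auto
  then have "1 / x \<le> conj_exp q / conj_exp p" by simp
  from hardy_young[OF pq _ this fin] x0
  have *: "ennreal (f powr q) + ennreal a * weighted_average p q \<le> ennreal (x powr (q - 1) * F)"
    using F by (simp add: a_def ennreal_mult'[symmetric] powr_divide powr_minus_divide[of x "q - 1", simplified])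
  \<comment> \<open>Finiteness of the average comes out of the inequality itself and has to precede
    the passage to real numbers.\<close>
  then have "ennreal a * weighted_average p q < top"
    by (metis (no_types) ennreal_less_top le_less_trans add.commute le_iff_add)
  then have "weighted_average p q < top"
    using a by (auto simp: ennreal_mult_less_top)
  then obtain A where A: "weighted_average p q = ennreal A" "0 \<le> A"
    by (cases "weighted_average p q") auto
  have "f powr q + a * A \<le> x powr (q - 1) * F"
    using * a A F by (simp add: ennreal_mult'[symmetric] flip: ennreal_plus)
  with f have "a * A \<le> x powr (q - 1) * F - F * (q * x powr (q - 1) - q * (1 - 1 / p) * x powr q)"
    by linarith
  also have "\<dots> = a * (x powr q * F)"
  proof -
    have "x powr (q - 1) = x powr q / x" using x0 by (simp add: powr_diff)
    then show ?thesis by (simp add: a_def algebra_simps diff_divide_distrib)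
  qed
  finally have "A \<le> x powr q * F" using a by simp
  then show ?thesis using A by (simp add: ennreal_leI)
qed

end

section \<open>Decreasing rearrangements\<close>

lemma rearrangement_measurable [measurable]:
  assumes [measurable]: "\<psi> \<in> borel_measurable M"
  shows "rearrangement M \<psi> \<in> borel_measurable borel"
  by (rule borel_measurableI_greater) (simp add: less_rearrangement_iff[OF assms])

text \<open>By equimeasurability both functions give every ray above \<open>s\<close> the same mass.
  The rays generate the Borel sets, so the two distributions agree and every Borel \<open>h\<close>
  has the same integral.\<close>

lemma nn_integral_rearrangement:
  assumes "prob_space M" and [measurable]: "\<psi> \<in> borel_measurable M" "h \<in> borel_measurable borel"
  shows "(\<integral>\<^sup>+x. h (\<psi> x) \<partial>M) = (\<integral>\<^sup>+t\<in>{0<..1}. h (rearrangement M \<psi> t) \<partial>lborel)"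
proof -
  interpret prob_space M by fact
  define N where "N = restrict_space lborel {0<..1::real}"
  have sN [simp]: "space N = {0<..1}" by (simp add: N_def space_restrict_space)
  have [measurable]: "rearrangement M \<psi> \<in> borel_measurable N"
    unfolding N_def by (intro measurable_restrict_space1) simp
  have "distr M borel \<psi> = distr N borel (rearrangement M \<psi>)"
  \<comment> \<open>\<open>UNIV\<close> joins the rays so that the total masses are compared too and
    a single set covers the space.\<close>
  proof (rule measure_eqI_generator_eq[where E="insert UNIV (range greaterThan)" and \<Omega>=UNIV and A="\<lambda>_. UNIV"])
    show "Int_stable (insert UNIV (range (greaterThan :: ennreal \<Rightarrow> _)))"
    proof -
      have "{a<..} \<inter> {b<..} = {max a b<..}" for a b :: ennreal by auto
      then show ?thesis by (simp add: Int_stable_def)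
    qed
    have "sets (borel :: ennreal measure) = sigma_sets UNIV (range greaterThan)"
      by (subst borel_Ioi) simp
    also have "\<dots> = sigma_sets UNIV (insert UNIV (range greaterThan))"
      by (intro sigma_sets_eqI) (auto intro: sigma_sets_top)
    finally show "sets (distr M borel \<psi>) = sigma_sets UNIV (insert UNIV (range greaterThan))"
      "sets (distr N borel (rearrangement M \<psi>)) = sigma_sets UNIV (insert UNIV (range greaterThan))"
      by auto
    have N_eq: "emeasure N A = emeasure lborel A" if "A \<subseteq> {0<..1}" for A
      using that by (simp add: N_def emeasure_restrict_space)
    fix A :: "ennreal set" assume A: "A \<in> insert UNIV (range greaterThan)"
    then consider "A = UNIV" | s where "A = {s<..}" by auto
    then show "emeasure (distr M borel \<psi>) A = emeasure (distr N borel (rearrangement M \<psi>)) A"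
    proof cases
      case 1
      then show ?thesis by (simp add: emeasure_distr N_eq emeasure_space_1)
    next
      case (2 s)
      have "emeasure (distr N borel (rearrangement M \<psi>)) A = emeasure N {t\<in>{0<..1}. s < rearrangement M \<psi> t}"
        unfolding 2 by (subst emeasure_distr) (auto simp: vimage_def Int_def conj_commute)
      also have "\<dots> = emeasure lborel {t\<in>{0<..1}. s < rearrangement M \<psi> t}"
        by (rule N_eq) auto
      also have "\<dots> = emeasure M {x\<in>space M. s < \<psi> x}"
        by (intro rearrangement_equimeasurable) (auto intro: assms)
      also have "\<dots> = emeasure (distr M borel \<psi>) A"
        unfolding 2 by (subst emeasure_distr) (auto simp: vimage_def Int_def conj_commute)
      finally show ?thesis ..
    qed
  qed (auto simp: emeasure_distr emeasure_space_1)
  then have "(\<integral>\<^sup>+y. h y \<partial>distr M borel \<psi>) = (\<integral>\<^sup>+y. h y \<partial>distr N borel (rearrangement M \<psi>))"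
    by simp
  then have "(\<integral>\<^sup>+x. h (\<psi> x) \<partial>M) = (\<integral>\<^sup>+t. h (rearrangement M \<psi> t) \<partial>N)"
    by (simp add: nn_integral_distr)
  then show ?thesis by (simp add: N_def nn_integral_restrict_space)
qed

lemma ennreal_le_add_diff: "(a :: ennreal) \<le> b + (a - b)"
  by (auto simp: add_diff_self_ennreal)

text \<open>The Hardy-Littlewood inequality. With \<open>s\<close> the rearrangement at the measure
  of \<open>E\<close>, the integrand is at most \<open>s\<close> plus the truncated difference
  \<open>\<psi> x - s\<close>. After rearrangement the latter lives on the interval up to the
  measure of \<open>E\<close>, where \<open>s\<close> can be added back.\<close>

lemma nn_integral_set_le_rearrangement:
  assumes "prob_space M" and [measurable]: "\<psi> \<in> borel_measurable M" "E \<in> sets M"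
    and fin: "(\<integral>\<^sup>+x. \<psi> x \<partial>M) < top" and pos: "0 < measure M E"
  shows "(\<integral>\<^sup>+x\<in>E. \<psi> x \<partial>M) \<le> (\<integral>\<^sup>+t\<in>{0<..measure M E}. rearrangement M \<psi> t \<partial>lborel)"
proof -
  interpret prob_space M by fact
  define e where "e = measure M E"
  define s where "s = rearrangement M \<psi> e"
  have e: "0 < e" "e \<le> 1" using pos by (auto simp: e_def)
  have "s * ennreal e = (\<integral>\<^sup>+t\<in>{0<..e}. s \<partial>lborel)"
    using e by (simp add: nn_integral_cmult_indicator)
  also have "\<dots> \<le> (\<integral>\<^sup>+t\<in>{0<..1}. rearrangement M \<psi> t \<partial>lborel)"
    using e by (intro nn_integral_mono) (auto simp: indicator_def s_def intro!: rearrangement_antimono)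
  also have "\<dots> = (\<integral>\<^sup>+x. \<psi> x \<partial>M)"
    by (rule nn_integral_rearrangement[OF assms(1), of \<psi> "\<lambda>y. y", symmetric]) auto
  also note fin
  finally have "s * ennreal e < top" .
  then have s: "s < top" using e by (auto simp: ennreal_mult_less_top)
  have "(\<integral>\<^sup>+x\<in>E. \<psi> x \<partial>M) \<le> (\<integral>\<^sup>+x. s * indicator E x + (\<psi> x - s) \<partial>M)"
    by (intro nn_integral_mono) (auto simp: indicator_def ennreal_le_add_diff)
  also have "\<dots> = s * ennreal e + (\<integral>\<^sup>+x. (\<psi> x - s) \<partial>M)"
    by (simp add: nn_integral_add nn_integral_cmult_indicator e_def emeasure_eq_measure)
  also have "(\<integral>\<^sup>+x. (\<psi> x - s) \<partial>M) = (\<integral>\<^sup>+t\<in>{0<..1}. (rearrangement M \<psi> t - s) \<partial>lborel)"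
    by (rule nn_integral_rearrangement[OF assms(1), of \<psi> "\<lambda>y. y - s"]) auto
  also have "\<dots> = (\<integral>\<^sup>+t\<in>{0<..e}. (rearrangement M \<psi> t - s) \<partial>lborel)"
  proof (intro nn_integral_cong)
    fix t
    have "rearrangement M \<psi> t - s = 0" if "e \<le> t"
      using rearrangement_antimono[OF that, of M \<psi>] s unfolding diff_eq_0_iff_ennreal s_def
      by (blast intro: le_less_trans)
    then show "(rearrangement M \<psi> t - s) * indicator {0<..1} t = (rearrangement M \<psi> t - s) * indicator {0<..e} t"
      using e by (cases "e \<le> t") (auto simp: indicator_def)
  qed
  also have "s * ennreal e = (\<integral>\<^sup>+t\<in>{0<..e}. s \<partial>lborel)"
    using e by (simp add: nn_integral_cmult_indicator)
  also have "(\<integral>\<^sup>+t\<in>{0<..e}. s \<partial>lborel) + (\<integral>\<^sup>+t\<in>{0<..e}. (rearrangement M \<psi> t - s) \<partial>lborel)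
      = (\<integral>\<^sup>+t. s * indicator {0<..e} t + (rearrangement M \<psi> t - s) * indicator {0<..e} t \<partial>lborel)"
    by (intro nn_integral_add[symmetric]) auto
  also have "\<dots> = (\<integral>\<^sup>+t\<in>{0<..e}. rearrangement M \<psi> t \<partial>lborel)"
    using rearrangement_antimono[of _ e M \<psi>]
    by (intro nn_integral_cong) (auto simp: indicator_def s_def add_diff_inverse_ennreal)
  finally show ?thesis by (simp add: e_def)
qed

text \<open>Past \<open>t\<close> the rearrangement is at most its value at \<open>t\<close>, before
  \<open>t\<close> at least that value. The comparison of averages is cross-multiplied to avoid
  division in \<open>ennreal\<close>.\<close>

lemma rearrangement_average_antimono:
  assumes [measurable]: "\<psi> \<in> borel_measurable M" and t: "0 < t" "t \<le> e"
  shows "ennreal t * (\<integral>\<^sup>+s\<in>{0<..e}. rearrangement M \<psi> s \<partial>lborel)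
    \<le> ennreal e * (\<integral>\<^sup>+s\<in>{0<..t}. rearrangement M \<psi> s \<partial>lborel)"
proof -
  define I where "I = (\<integral>\<^sup>+s\<in>{0<..t}. rearrangement M \<psi> s \<partial>lborel)"
  have "{0<..e} = {0<..t} \<union> {t<..e}" using t by auto
  then have "(\<integral>\<^sup>+s\<in>{0<..e}. rearrangement M \<psi> s \<partial>lborel) = I + (\<integral>\<^sup>+s\<in>{t<..e}. rearrangement M \<psi> s \<partial>lborel)"
    unfolding I_def by (simp only:) (intro nn_integral_disjoint_pair, auto)
  also have "(\<integral>\<^sup>+s\<in>{t<..e}. rearrangement M \<psi> s \<partial>lborel) \<le> (\<integral>\<^sup>+s\<in>{t<..e}. rearrangement M \<psi> t \<partial>lborel)"
    by (intro nn_integral_mono) (auto simp: indicator_def intro!: rearrangement_antimono)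
  also have "\<dots> = rearrangement M \<psi> t * ennreal (e - t)"
    using t by (simp add: nn_integral_cmult_indicator)
  finally have 1: "(\<integral>\<^sup>+s\<in>{0<..e}. rearrangement M \<psi> s \<partial>lborel) \<le> I + rearrangement M \<psi> t * ennreal (e - t)"
    by (simp add: add_left_mono)
  have "rearrangement M \<psi> t * ennreal t = (\<integral>\<^sup>+s\<in>{0<..t}. rearrangement M \<psi> t \<partial>lborel)"
    using t by (simp add: nn_integral_cmult_indicator)
  also have "\<dots> \<le> I"
    unfolding I_def by (intro nn_integral_mono) (auto simp: indicator_def intro!: rearrangement_antimono)
  finally have 2: "rearrangement M \<psi> t * ennreal t \<le> I" .
  have "ennreal t * (\<integral>\<^sup>+s\<in>{0<..e}. rearrangement M \<psi> s \<partial>lborel)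
      \<le> ennreal t * (I + rearrangement M \<psi> t * ennreal (e - t))"
    by (intro mult_left_mono 1) auto
  also have "\<dots> = ennreal t * I + ennreal (e - t) * (rearrangement M \<psi> t * ennreal t)"
    by (simp add: distrib_left mult_ac)
  also have "\<dots> \<le> ennreal t * I + ennreal (e - t) * I"
    by (intro add_left_mono mult_left_mono 2) auto
  also have "\<dots> = ennreal e * I"
    using t by (simp add: distrib_right[symmetric] flip: ennreal_plus)
  finally show ?thesis by (simp add: I_def)
qed

section \<open>Trees and the weak-type inequality\<close>

text \<open>
  \<open>tree_level\<close> is used with two successor maps: the children map of the tree, and a map \<open>S\<close> whose
  sets cover only a fixed proportion of their parent.
\<close>

locale descent = prob_space M for M :: "'a measure" +
  fixes T :: "'a set set" and S :: "'a set \<Rightarrow> 'a set set"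
  assumes T_sets: "T \<subseteq> sets M"
    and S_sub: "\<And>I. I \<in> T \<Longrightarrow> S I \<subseteq> T"
    and S_fin: "\<And>I. I \<in> T \<Longrightarrow> finite (S I)"
    and S_le: "\<And>I J. I \<in> T \<Longrightarrow> J \<in> S I \<Longrightarrow> J \<subseteq> I"
    and S_ad: "\<And>I. I \<in> T \<Longrightarrow> pairwise (\<lambda>J K. emeasure M (J \<inter> K) = 0) (S I)"
begin

lemma T_meas [measurable]: "I \<in> T \<Longrightarrow> I \<in> sets M"
  using T_sets by auto

lemma level_sub: "I \<in> T \<Longrightarrow> tree_level I S n \<subseteq> T"
  by (induction n) (use S_sub in auto)

lemma level_fin: "I \<in> T \<Longrightarrow> finite (tree_level I S n)"
  by (induction n) (use S_fin level_sub in auto)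

lemma level_le: "I \<in> T \<Longrightarrow> J \<in> tree_level I S n \<Longrightarrow> J \<subseteq> I"
proof (induction n arbitrary: J)
  case (Suc n)
  then obtain K where K: "K \<in> tree_level I S n" "J \<in> S K" by auto
  with Suc.prems(1) level_sub have "K \<in> T" by blast
  with K Suc show ?case using S_le by blast
qed simp

lemma level_add: "tree_level I S (m + n) = (\<Union>J\<in>tree_level I S m. tree_level J S n)"
  by (induction n) auto

lemma level_ad:
  assumes I: "I \<in> T"
  shows "pairwise (\<lambda>J K. emeasure M (J \<inter> K) = 0) (tree_level I S n)"
proof (induction n)
  case (Suc n)
  show ?case
  proof (rule pairwiseI)
    fix J K assume JK: "J \<in> tree_level I S (Suc n)" "K \<in> tree_level I S (Suc n)" "J \<noteq> K"
    then obtain J' K' where *: "J' \<in> tree_level I S n" "J \<in> S J'" "K' \<in> tree_level I S n" "K \<in> S K'" by auto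
    then have T: "J' \<in> T" "K' \<in> T" using level_sub[OF I] by auto
    show "emeasure M (J \<inter> K) = 0"
    proof (cases "J' = K'")
      case True
      then show ?thesis using S_ad[OF T(1)] * JK by (auto simp: pairwise_def)
    next
      case False
      then have "emeasure M (J' \<inter> K') = 0" using Suc * by (auto simp: pairwise_def)
      moreover have "J \<inter> K \<subseteq> J' \<inter> K'" using * T S_le by blast
      moreover have "J' \<inter> K' \<in> sets M" using T by auto
      ultimately show ?thesis
        by (metis emeasure_mono le_zero_eq)
    qed
  qed
qed simp

text \<open>Subsets of almost disjoint sets are almost disjoint. Used with \<open>H J = J\<close>
  for one generation and with the union of \<open>S J\<close> for the next.\<close>

lemma measure_UN_ad:
  assumes "finite F" "F \<subseteq> T" "pairwise (\<lambda>J K. emeasure M (J \<inter> K) = 0) F"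
    and H: "\<And>J. J \<in> F \<Longrightarrow> H J \<in> sets M" "\<And>J. J \<in> F \<Longrightarrow> H J \<subseteq> J"
  shows "prob (\<Union>J\<in>F. H J) = (\<Sum>J\<in>F. prob (H J))"
proof (rule measure_UNION_AE)
  show "pairwise (\<lambda>i j. AE x in M. x \<notin> H i \<or> x \<notin> H j) F"
  proof (rule pairwiseI)
    fix i j assume ij: "i \<in> F" "j \<in> F" "i \<noteq> j"
    moreover have "i \<in> sets M" "j \<in> sets M" using ij assms(2) T_sets by auto
    ultimately have "i \<inter> j \<in> null_sets M" using assms(3) by (auto simp: pairwise_def null_sets_def)
    then have "AE x in M. x \<notin> i \<inter> j" by (rule AE_not_in)
    then show "AE x in M. x \<notin> H i \<or> x \<notin> H j"
      by eventually_elim (use ij H in auto)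
  qed
qed (simp_all add: assms(1) H(1) fmeasurable_eq_sets)

lemma level_Union_sets [measurable]: "I \<in> T \<Longrightarrow> \<Union>(tree_level I S n) \<in> sets M"
  using level_sub[of I n] by (intro sets.finite_Union level_fin) auto

lemma succ_Union_sets [measurable]: "I \<in> T \<Longrightarrow> \<Union>(S I) \<in> sets M"
  using level_Union_sets[of I 1] by simp

lemma measure_level_Suc:
  assumes I: "I \<in> T"
  shows "prob (\<Union>(tree_level I S (Suc n))) = (\<Sum>J\<in>tree_level I S n. prob (\<Union>(S J)))"
proof -
  have "\<Union>(tree_level I S (Suc n)) = (\<Union>J\<in>tree_level I S n. \<Union>(S J))" by auto
  moreover have JT: "J \<in> T" if "J \<in> tree_level I S n" for J
    using that level_sub[OF I, of n] by auto
  have "prob (\<Union>J\<in>tree_level I S n. \<Union>(S J)) = (\<Sum>J\<in>tree_level I S n. prob (\<Union>(S J)))"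
    using S_le[OF JT] by (intro measure_UN_ad level_fin level_sub level_ad I succ_Union_sets JT) auto
  ultimately show ?thesis by simp
qed

lemma measure_level:
  assumes I: "I \<in> T"
  shows "prob (\<Union>(tree_level I S n)) = (\<Sum>J\<in>tree_level I S n. prob J)"
proof -
  have "prob (\<Union>J\<in>tree_level I S n. J) = (\<Sum>J\<in>tree_level I S n. prob J)"
    by (intro measure_UN_ad level_fin level_sub level_ad I T_meas[OF subsetD[OF level_sub[OF I]]]) auto
  then show ?thesis by (simp only: image_ident)
qed

text \<open>The proportions multiply from generation to generation. In
  \<open>ex_power_profile\<close> the lower bound feeds the averages and the superlevel sets, the
  upper bound the size of the function.\<close>

lemma measure_level_bounds:
  assumes I: "I \<in> T" and lo: "0 \<le> lo" and hi: "0 \<le> hi"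
    and b: "\<And>J. J \<in> T \<Longrightarrow> lo * prob J \<le> prob (\<Union>(S J)) \<and> prob (\<Union>(S J)) \<le> hi * prob J"
  shows "lo ^ n * prob I \<le> prob (\<Union>(tree_level I S n)) \<and> prob (\<Union>(tree_level I S n)) \<le> hi ^ n * prob I"
proof (induction n)
  case (Suc n)
  have "(\<Sum>J\<in>tree_level I S n. lo * prob J) \<le> prob (\<Union>(tree_level I S (Suc n)))"
    "prob (\<Union>(tree_level I S (Suc n))) \<le> (\<Sum>J\<in>tree_level I S n. hi * prob J)"
    unfolding measure_level_Suc[OF I] using b level_sub[OF I, of n] by (auto intro!: sum_mono)
  then have *: "lo * prob (\<Union>(tree_level I S n)) \<le> prob (\<Union>(tree_level I S (Suc n)))"
    "prob (\<Union>(tree_level I S (Suc n))) \<le> hi * prob (\<Union>(tree_level I S n))"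
    unfolding measure_level[OF I, of n] by (simp_all add: sum_distrib_left)
  have "lo ^ Suc n * prob I \<le> lo * prob (\<Union>(tree_level I S n))"
    "hi * prob (\<Union>(tree_level I S n)) \<le> hi ^ Suc n * prob I"
    using Suc lo hi by (auto simp: mult.assoc intro!: mult_left_mono)
  with * show ?case by linarith
qed auto

end

lemma nn_integral_Union_null:
  assumes "finite F" and [measurable]: "\<phi> \<in> borel_measurable M" and H: "\<And>J. J \<in> F \<Longrightarrow> H J \<in> sets M"
    and ad: "pairwise (\<lambda>J K. H J \<inter> H K \<in> null_sets M) F"
  shows "(\<integral>\<^sup>+x\<in>(\<Union>J\<in>F. H J). \<phi> x \<partial>M) = (\<Sum>J\<in>F. \<integral>\<^sup>+x\<in>H J. \<phi> x \<partial>M)"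
  using assms(1) H ad
proof (induction F rule: finite_induct)
  case (insert J F)
  have [measurable]: "H J \<in> sets M" "(\<Union>K\<in>F. H K) \<in> sets M"
    using insert by (auto intro!: sets.finite_UN)
  have "(\<Union>K\<in>F. H J \<inter> H K) \<in> null_sets M"
    using insert by (intro null_sets_UN' countable_finite) (auto simp: pairwise_def)
  then have "AE x in M. x \<notin> (\<Union>K\<in>F. H J \<inter> H K)"
    by (rule AE_not_in)
  then have "(\<integral>\<^sup>+x\<in>(\<Union>K\<in>insert J F. H K). \<phi> x \<partial>M)
      = (\<integral>\<^sup>+x. \<phi> x * indicator (H J) x + \<phi> x * indicator (\<Union>K\<in>F. H K) x \<partial>M)"
    by (intro nn_integral_cong_AE, eventually_elim) (auto simp: indicator_def)
  also have "\<dots> = (\<integral>\<^sup>+x\<in>H J. \<phi> x \<partial>M) + (\<integral>\<^sup>+x\<in>(\<Union>K\<in>F. H K). \<phi> x \<partial>M)"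
    by (intro nn_integral_add) auto
  also have "(\<integral>\<^sup>+x\<in>(\<Union>K\<in>F. H K). \<phi> x \<partial>M) = (\<Sum>K\<in>F. \<integral>\<^sup>+x\<in>H K. \<phi> x \<partial>M)"
    using insert by (intro insert.IH) (auto simp: pairwise_insert)
  finally show ?case using insert by simp
qed simp

section \<open>The maximal operator of a tree\<close>

locale tree_space = descent M T C for M :: "'a measure" and T C +
  assumes root: "space M \<in> T"
    and pos: "\<And>I. I \<in> T \<Longrightarrow> 0 < emeasure M I"
    and C_Un: "\<And>I. I \<in> T \<Longrightarrow> I = \<Union>(C I)"
    and T_eq: "T = (\<Union>m. tree_level (space M) C m)"
    and lim: "(\<lambda>m. SUP I\<in>tree_level (space M) C m. emeasure M I) \<longlonglongrightarrow> 0"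
begin

lemma countable_T: "countable T"
  using level_fin[OF root] by (subst T_eq) (auto intro: countable_finite)

lemma level_Un: "I \<in> T \<Longrightarrow> \<Union>(tree_level I C n) = I"
proof (induction n)
  case (Suc n)
  have "\<Union>(tree_level I C (Suc n)) = (\<Union>J\<in>tree_level I C n. \<Union>(C J))" by auto
  also have "\<dots> = (\<Union>J\<in>tree_level I C n. J)"
    using C_Un level_sub[OF Suc.prems, of n] by (intro SUP_cong) auto
  finally show ?case using Suc by simp
qed simp

definition stop :: "('a \<Rightarrow> ennreal) \<Rightarrow> ennreal \<Rightarrow> 'a set \<Rightarrow> bool" where
  "stop \<phi> s I \<longleftrightarrow> s < (\<integral>\<^sup>+x\<in>I. \<phi> x \<partial>M) / emeasure M I"

text \<open>
  Down to depth \<open>n\<close> below \<open>I\<close>, the union of the largest tree sets with average above \<open>s\<close>: the descent stops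
  at the first such set, so the pieces are almost disjoint.
\<close>

primrec hit :: "('a \<Rightarrow> ennreal) \<Rightarrow> ennreal \<Rightarrow> nat \<Rightarrow> 'a set \<Rightarrow> 'a set" where
  "hit \<phi> s 0 I = (if stop \<phi> s I then I else {})"
| "hit \<phi> s (Suc n) I = (if stop \<phi> s I then I else (\<Union>J\<in>C I. hit \<phi> s n J))"

lemma hit_sets_le: "I \<in> T \<Longrightarrow> hit \<phi> s n I \<in> sets M \<and> hit \<phi> s n I \<subseteq> I"
proof (induction n arbitrary: I)
  case (Suc n)
  then have "\<And>J. J \<in> C I \<Longrightarrow> J \<in> T" using S_sub by auto
  with Suc S_fin[OF Suc.prems] S_le[OF Suc.prems] show ?case
    by (auto intro!: sets.finite_UN)
qed (simp add: T_meas)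

lemma stop_imp:
  assumes "I \<in> T" "stop \<phi> s I"
  shows "s * emeasure M I \<le> (\<integral>\<^sup>+x\<in>I. \<phi> x \<partial>M)"
proof -
  have "s * emeasure M I \<le> (\<integral>\<^sup>+x\<in>I. \<phi> x \<partial>M) / emeasure M I * emeasure M I"
    using assms by (intro mult_right_mono) (auto simp: stop_def)
  also have "\<dots> = (\<integral>\<^sup>+x\<in>I. \<phi> x \<partial>M)"
  proof -
    have "emeasure M I / emeasure M I = 1"
      using pos[OF assms(1)] by (intro ennreal_divide_self) (auto simp: less_top[symmetric])
    then show ?thesis by (simp add: ennreal_divide_times)
  qed
  finally show ?thesis .
qed

text \<open>Induction on the depth of the descent. For measures subadditivity goes in the right
  direction; for integrals it does not, and additivity rests on the almost disjointness of the
  children.\<close>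

lemma hit_weak_type:
  assumes [measurable]: "\<phi> \<in> borel_measurable M"
  shows "I \<in> T \<Longrightarrow> s * emeasure M (hit \<phi> s n I) \<le> (\<integral>\<^sup>+x\<in>hit \<phi> s n I. \<phi> x \<partial>M)"
proof (induction n arbitrary: I)
  case 0
  then show ?case using stop_imp by auto
next
  case (Suc n)
  have CT: "\<And>J. J \<in> C I \<Longrightarrow> J \<in> T" using S_sub[OF Suc.prems] by auto
  show ?case
  proof (cases "stop \<phi> s I")
    case False
    have meas: "\<And>J. J \<in> C I \<Longrightarrow> hit \<phi> s n J \<in> sets M" using CT hit_sets_le by blast
    have "emeasure M (\<Union>J\<in>C I. hit \<phi> s n J) \<le> (\<Sum>J\<in>C I. emeasure M (hit \<phi> s n J))"
      using S_fin[OF Suc.prems] meas by (intro emeasure_subadditive_finite) auto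
    then have "s * emeasure M (\<Union>J\<in>C I. hit \<phi> s n J) \<le> (\<Sum>J\<in>C I. s * emeasure M (hit \<phi> s n J))"
      by (simp add: mult_left_mono flip: sum_distrib_left)
    also have "\<dots> \<le> (\<Sum>J\<in>C I. \<integral>\<^sup>+x\<in>hit \<phi> s n J. \<phi> x \<partial>M)"
      by (intro sum_mono Suc.IH CT)
    also have "\<dots> = (\<integral>\<^sup>+x\<in>(\<Union>J\<in>C I. hit \<phi> s n J). \<phi> x \<partial>M)"
    proof (intro nn_integral_Union_null[symmetric] S_fin Suc.prems meas assms pairwiseI)
      fix J K assume JK: "J \<in> C I" "K \<in> C I" "J \<noteq> K"
      then have "J \<inter> K \<in> null_sets M"
        using S_ad[OF Suc.prems] CT by (auto simp: pairwise_def null_sets_def)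
      moreover have "hit \<phi> s n J \<inter> hit \<phi> s n K \<in> sets M"
        using meas[OF JK(1)] meas[OF JK(2)] by (rule sets.Int)
      moreover have "hit \<phi> s n J \<inter> hit \<phi> s n K \<subseteq> J \<inter> K"
        using hit_sets_le[OF CT[OF JK(1)], of \<phi> s n] hit_sets_le[OF CT[OF JK(2)], of \<phi> s n] by auto
      ultimately show "hit \<phi> s n J \<inter> hit \<phi> s n K \<in> null_sets M"
        by (rule null_sets_subset)
    qed
    finally show ?thesis using False by simp
  qed (simp add: stop_imp Suc.prems)
qed

lemma hit_mono: "hit \<phi> s n I \<subseteq> hit \<phi> s (Suc n) I"
proof (induction n arbitrary: I)
  case (Suc n)
  show ?case
  proof (cases "stop \<phi> s I")
    case False
    have "(\<Union>J\<in>C I. hit \<phi> s n J) \<subseteq> (\<Union>J\<in>C I. hit \<phi> s (Suc n) J)"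
      using Suc by blast
    with False show ?thesis by (simp del: hit.simps(2) add: hit.simps(2)[of _ _ _ I])
  qed simp
qed simp

text \<open>If the descent stops above \<open>J\<close>, the set where it stops contains
  \<open>J\<close>.\<close>

lemma hit_level: "I \<in> T \<Longrightarrow> J \<in> tree_level I C n \<Longrightarrow> stop \<phi> s J \<Longrightarrow> J \<subseteq> hit \<phi> s n I"
proof (induction n arbitrary: I)
  case (Suc n)
  have "tree_level I C (Suc n) = (\<Union>K\<in>C I. tree_level K C n)"
    using level_add[of I 1 n] by simp
  with Suc.prems obtain K where K: "K \<in> C I" "J \<in> tree_level K C n" by blast
  then have "J \<subseteq> hit \<phi> s n K" using Suc S_sub by blast
  moreover have "J \<subseteq> I" using Suc.prems level_le by blast
  ultimately show ?case using K by auto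
qed simp

lemma hit_stop: "I \<in> T \<Longrightarrow> x \<in> hit \<phi> s n I \<Longrightarrow> \<exists>J\<in>T. x \<in> J \<and> stop \<phi> s J"
proof (induction n arbitrary: I)
  case (Suc n)
  then show ?case using S_sub[of I] by (auto split: if_splits)
qed (auto split: if_splits)

text \<open>An exhaustion by descents of finite depth: it yields both the measurability of the
  maximal function and, by monotone limits, the weak-type inequality.\<close>

lemma tree_maximal_superlevel:
  "{x\<in>space M. s < tree_maximal M T \<phi> x} = (\<Union>n. hit (\<lambda>x. ennreal \<bar>\<phi> x\<bar>) s n (space M))" (is "?L = ?R")
proof
  show "?L \<subseteq> ?R"
  proof
    fix x assume "x \<in> ?L"
    then obtain I where I: "I \<in> T" "x \<in> I" "stop (\<lambda>x. ennreal \<bar>\<phi> x\<bar>) s I"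
      by (auto simp: tree_maximal_def less_SUP_iff stop_def)
    from I(1) obtain n where "I \<in> tree_level (space M) C n" using T_eq by blast
    with I hit_level[OF root] show "x \<in> ?R" by blast
  qed
  show "?R \<subseteq> ?L"
  proof
    fix x assume "x \<in> ?R"
    then obtain n where n: "x \<in> hit (\<lambda>x. ennreal \<bar>\<phi> x\<bar>) s n (space M)" by auto
    with hit_stop[OF root] obtain J where "J \<in> T" "x \<in> J" "stop (\<lambda>x. ennreal \<bar>\<phi> x\<bar>) s J" by blast
    moreover have "x \<in> space M" using n hit_sets_le[OF root] by blast
    ultimately show "x \<in> ?L" by (auto simp: tree_maximal_def less_SUP_iff stop_def)
  qed
qed

lemma tree_maximal_measurable [measurable]: "tree_maximal M T \<phi> \<in> borel_measurable M"
  using hit_sets_le[OF root] by (intro borel_measurableI_greater) (auto simp: tree_maximal_superlevel)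

lemma tree_maximal_weak_type:
  assumes [measurable]: "\<phi> \<in> borel_measurable M"
  defines "E s \<equiv> {x\<in>space M. s < tree_maximal M T \<phi> x}"
  shows "s * emeasure M (E s) \<le> (\<integral>\<^sup>+x\<in>E s. ennreal \<bar>\<phi> x\<bar> \<partial>M)"
proof -
  let ?H = "\<lambda>n. hit (\<lambda>x. ennreal \<bar>\<phi> x\<bar>) s n (space M)"
  have "emeasure M (E s) = (SUP n. emeasure M (?H n))"
    unfolding E_def tree_maximal_superlevel using hit_sets_le[OF root]
    by (intro SUP_emeasure_incseq[symmetric] incseq_SucI hit_mono) auto
  then have "s * emeasure M (E s) = (SUP n. s * emeasure M (?H n))"
    by (simp add: SUP_mult_left_ennreal)
  also have "\<dots> \<le> (\<integral>\<^sup>+x\<in>E s. ennreal \<bar>\<phi> x\<bar> \<partial>M)"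
  proof (rule SUP_least)
    fix n
    have "s * emeasure M (?H n) \<le> (\<integral>\<^sup>+x\<in>?H n. ennreal \<bar>\<phi> x\<bar> \<partial>M)"
      by (intro hit_weak_type root) simp
    also have "\<dots> \<le> (\<integral>\<^sup>+x\<in>E s. ennreal \<bar>\<phi> x\<bar> \<partial>M)"
      unfolding E_def tree_maximal_superlevel by (intro nn_integral_mono) (auto simp: indicator_def)
    finally show "s * emeasure M (?H n) \<le> (\<integral>\<^sup>+x\<in>E s. ennreal \<bar>\<phi> x\<bar> \<partial>M)" .
  qed
  finally show ?thesis .
qed

text \<open>For \<open>s\<close> below the left side, the superlevel set \<open>E\<close> has
  measure greater than \<open>t\<close>. Weak type and Hardy-Littlewood bound \<open>s\<close> by
  the average up to \<open>prob E\<close>, which is at most the average up to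
  \<open>t\<close>.\<close>

lemma rearrangement_tree_maximal_le:
  assumes [measurable]: "\<phi> \<in> borel_measurable M" and t: "0 < t"
    and fin: "(\<integral>\<^sup>+x. ennreal \<bar>\<phi> x\<bar> \<partial>M) < top"
  shows "rearrangement M (tree_maximal M T \<phi>) t
    \<le> (\<integral>\<^sup>+s\<in>{0<..t}. rearrangement M (\<lambda>x. ennreal \<bar>\<phi> x\<bar>) s \<partial>lborel) / ennreal t"
proof (rule dense_le)
  fix s assume s: "s < rearrangement M (tree_maximal M T \<phi>) t"
  let ?I = "\<lambda>t. \<integral>\<^sup>+s\<in>{0<..t}. rearrangement M (\<lambda>x. ennreal \<bar>\<phi> x\<bar>) s \<partial>lborel"
  define E where "E = {x\<in>space M. s < tree_maximal M T \<phi> x}"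
  have [measurable]: "E \<in> sets M" unfolding E_def by measurable
  have "ennreal t < ennreal (prob E)"
    using s by (simp add: less_rearrangement_iff E_def emeasure_eq_measure)
  then have e: "t < prob E" using t by (simp add: ennreal_less_iff)
  have "ennreal (prob E) * s \<le> (\<integral>\<^sup>+x\<in>E. ennreal \<bar>\<phi> x\<bar> \<partial>M)"
    using tree_maximal_weak_type[of \<phi> s] by (simp add: E_def emeasure_eq_measure mult.commute)
  also have "\<dots> \<le> ?I (prob E)"
    using e t by (intro nn_integral_set_le_rearrangement fin prob_space_axioms) auto
  finally have "ennreal t * (ennreal (prob E) * s) \<le> ennreal t * ?I (prob E)"
    by (intro mult_left_mono) auto
  also have "\<dots> \<le> ennreal (prob E) * ?I t"
    using t e by (intro rearrangement_average_antimono) auto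
  finally have "ennreal (prob E) * (s * ennreal t) \<le> ennreal (prob E) * ?I t"
    by (simp add: mult_ac)
  then have "s * ennreal t \<le> ?I t"
    using e t by (subst (asm) ennreal_mult_le_mult_iff) auto
  then have "s * ennreal t / ennreal t \<le> ?I t / ennreal t"
    by (rule divide_right_mono_ennreal)
  then show "s \<le> ?I t / ennreal t"
    using t by (simp add: mult_divide_eq_ennreal)
qed

end

section \<open>The Lorentz norm of the maximal function\<close>

lemma ennpowr_mono: "a \<le> b \<Longrightarrow> 0 \<le> r \<Longrightarrow> ennpowr a r \<le> ennpowr b r"
  by (cases a; cases b) (auto simp: ennpowr_def top_unique intro!: ennreal_leI powr_mono2)

lemma lorentz_integrand:
  assumes "0 < t" "0 \<le> y" "0 < q"
  shows "ennpowr (ennreal (t powr (1 / p)) * ennreal y) q / ennreal t = ennreal (t powr (q / p - 1) * y powr q)"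
proof -
  have "ennreal (t powr (1 / p)) * ennreal y = ennreal (t powr (1 / p) * y)"
    using assms by (simp add: ennreal_mult')
  moreover have "(t powr (1 / p) * y) powr q / t = t powr (q / p - 1) * y powr q"
    using assms by (simp add: powr_mult powr_powr powr_diff)
  ultimately show ?thesis
    using assms by (simp add: ennpowr_def divide_ennreal)
qed

lemma lorentz_norm_le:
  assumes "0 < q" and le: "\<And>t. 0 < t \<Longrightarrow> t < 1 \<Longrightarrow> rearrangement M \<psi> t \<le> ennreal (h t)"
    and h: "\<And>t. 0 < t \<Longrightarrow> t < 1 \<Longrightarrow> 0 \<le> h t"
  shows "ennpowr (lorentz_norm M p q \<psi>) q \<le> (\<integral>\<^sup>+t\<in>{0<..1}. ennreal (t powr (q / p - 1) * h t powr q) \<partial>lborel)"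
  unfolding lorentz_norm_powr[OF assms(1)]
proof (rule nn_integral_mono_AE)
  show "AE t in lborel. ennpowr (ennreal (t powr (1 / p)) * rearrangement M \<psi> t) q / ennreal t * indicator {0<..1} t
      \<le> ennreal (t powr (q / p - 1) * h t powr q) * indicator {0<..1} t"
    using AE_lborel_singleton[of 1]
  proof eventually_elim
    case (elim t)
    show ?case
    proof (cases "0 < t \<and> t < 1")
      case True
      then have "ennpowr (ennreal (t powr (1 / p)) * rearrangement M \<psi> t) q / ennreal t
          \<le> ennpowr (ennreal (t powr (1 / p)) * ennreal (h t)) q / ennreal t"
        using assms(1) by (intro divide_right_mono_ennreal ennpowr_mono mult_left_mono le) auto
      with True show ?thesis using assms(1) h by (simp add: lorentz_integrand)
    qed (use elim in \<open>auto simp: indicator_def\<close>)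
  qed
qed

text \<open>The hypothesis stops short of \<open>t = 1\<close>, where \<open>rearrangement\<close>
  takes the value 0 and would contradict a positive lower bound.\<close>

lemma lorentz_norm_ge:
  assumes "0 < q" and le: "\<And>t. 0 < t \<Longrightarrow> t < 1 \<Longrightarrow> ennreal (h t) \<le> rearrangement M \<psi> t"
    and h: "\<And>t. 0 < t \<Longrightarrow> t < 1 \<Longrightarrow> 0 \<le> h t"
  shows "(\<integral>\<^sup>+t\<in>{0<..1}. ennreal (t powr (q / p - 1) * h t powr q) \<partial>lborel) \<le> ennpowr (lorentz_norm M p q \<psi>) q"
  unfolding lorentz_norm_powr[OF assms(1)]
proof (rule nn_integral_mono_AE)
  show "AE t in lborel. ennreal (t powr (q / p - 1) * h t powr q) * indicator {0<..1} t
      \<le> ennpowr (ennreal (t powr (1 / p)) * rearrangement M \<psi> t) q / ennreal t * indicator {0<..1} t"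
    using AE_lborel_singleton[of 1]
  proof eventually_elim
    case (elim t)
    show ?case
    proof (cases "0 < t \<and> t < 1")
      case True
      then have "ennpowr (ennreal (t powr (1 / p)) * ennreal (h t)) q / ennreal t
          \<le> ennpowr (ennreal (t powr (1 / p)) * rearrangement M \<psi> t) q / ennreal t"
        using assms(1) by (intro divide_right_mono_ennreal ennpowr_mono mult_left_mono le) auto
      with True show ?thesis using assms(1) h by (simp add: lorentz_integrand)
    qed (use elim in \<open>auto simp: indicator_def\<close>)
  qed
qed

lemma rearrangement_less_top:
  assumes "prob_space M" and [measurable]: "\<psi> \<in> borel_measurable M"
    and fin: "(\<integral>\<^sup>+x. \<psi> x \<partial>M) < top" and t: "0 < t" "t \<le> 1"
  shows "rearrangement M \<psi> t < top"
proof -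
  have "rearrangement M \<psi> t * ennreal t = (\<integral>\<^sup>+s\<in>{0<..t}. rearrangement M \<psi> t \<partial>lborel)"
    using t by (simp add: nn_integral_cmult_indicator)
  also have "\<dots> \<le> (\<integral>\<^sup>+s\<in>{0<..1}. rearrangement M \<psi> s \<partial>lborel)"
    using t by (intro nn_integral_mono) (auto simp: indicator_def intro!: rearrangement_antimono)
  also have "\<dots> = (\<integral>\<^sup>+x. \<psi> x \<partial>M)"
    by (rule nn_integral_rearrangement[OF assms(1), of \<psi> "\<lambda>y. y", symmetric]) auto
  also note fin
  finally show ?thesis using t by (auto simp: ennreal_mult_less_top)
qed

context tree_space
begin

text \<open>Reduces the upper bound to one non-increasing function on (0,1];
  \<open>bellman_le\<close> and \<open>admissible_imp_le\<close> use nothing else about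
  \<open>\<phi>\<close>.\<close>

lemma admissible_profile:
  assumes adm: "\<phi> \<in> bellman_admissible M p q F f" and pq: "1 < p" "1 < q" and f: "0 < f"
  obtains g where "decreasing_profile g f"
    "(\<integral>\<^sup>+t\<in>{0<..1}. ennreal (t powr (q / p - 1) * g t powr q) \<partial>lborel) = ennreal F"
    "ennpowr (lorentz_norm M p q (tree_maximal M T \<phi>)) q \<le> decreasing_profile.weighted_average g p q"
proof -
  let ?\<psi> = "\<lambda>x. ennreal \<bar>\<phi> x\<bar>"
  define g where "g t = enn2real (rearrangement M ?\<psi> t)" for t
  have [measurable]: "\<phi> \<in> borel_measurable M"
    and mass: "(\<integral>\<^sup>+x. ?\<psi> x \<partial>M) = ennreal f"
    and lor: "ennpowr (lorentz_norm M p q ?\<psi>) q = ennreal F"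
    using adm by (auto simp: bellman_admissible_def)
  have fin: "(\<integral>\<^sup>+x. ?\<psi> x \<partial>M) < top" by (simp add: mass)
  have g: "rearrangement M ?\<psi> t = ennreal (g t)" if "0 < t" "t \<le> 1" for t
    unfolding g_def by (intro ennreal_enn2real[symmetric] rearrangement_less_top prob_space_axioms fin that) auto
  have g0: "0 \<le> g t" for t by (simp add: g_def)
  have [measurable]: "g \<in> borel_measurable borel" unfolding g_def [abs_def] by measurable
  interpret G: decreasing_profile g f
  proof
    show "g t \<le> g s" if "0 < s" "s \<le> t" "t \<le> 1" for s t
      using rearrangement_antimono[OF that(2), of M ?\<psi>] g[of s] g[of t] that g0 by simp
    have "(\<integral>\<^sup>+t\<in>{0<..1}. ennreal (g t) \<partial>lborel) = (\<integral>\<^sup>+t\<in>{0<..1}. rearrangement M ?\<psi> t \<partial>lborel)"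
      by (intro nn_integral_cong) (auto simp: indicator_def g)
    also have "\<dots> = (\<integral>\<^sup>+x. ?\<psi> x \<partial>M)"
      by (rule nn_integral_rearrangement[OF prob_space_axioms, of ?\<psi> "\<lambda>y. y", symmetric]) auto
    finally show "(\<integral>\<^sup>+t\<in>{0<..1}. ennreal (g t) \<partial>lborel) = ennreal f" by (simp add: mass)
  qed (use f g0 in auto)
  have "(\<integral>\<^sup>+t\<in>{0<..1}. ennreal (t powr (q / p - 1) * g t powr q) \<partial>lborel) = ennpowr (lorentz_norm M p q ?\<psi>) q"
    using pq by (intro antisym lorentz_norm_le lorentz_norm_ge) (auto simp: g g0)
  moreover have "rearrangement M (tree_maximal M T \<phi>) t \<le> ennreal (G.\<Phi> t / t)" if "0 < t" "t < 1" for t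
  proof -
    have "rearrangement M (tree_maximal M T \<phi>) t \<le> (\<integral>\<^sup>+s\<in>{0<..t}. rearrangement M ?\<psi> s \<partial>lborel) / ennreal t"
      using that fin by (intro rearrangement_tree_maximal_le) auto
    also have "(\<integral>\<^sup>+s\<in>{0<..t}. rearrangement M ?\<psi> s \<partial>lborel) = (\<integral>\<^sup>+s\<in>{0<..t}. ennreal (g s) \<partial>lborel)"
      using that by (intro nn_integral_cong) (auto simp: indicator_def g)
    also have "\<dots> = ennreal (G.\<Phi> t)" using that by (simp add: G.ennreal_\<Phi>)
    finally show ?thesis using that by (simp add: divide_ennreal G.\<Phi>_nonneg)
  qed
  then have "ennpowr (lorentz_norm M p q (tree_maximal M T \<phi>)) q \<le> G.weighted_average p q"
    unfolding G.weighted_average_def using pq by (intro lorentz_norm_le) (auto simp: G.\<Phi>_nonneg)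
  ultimately show thesis
    using that G.decreasing_profile_axioms lor by simp
qed

end

section \<open>A uniformly distributed function adapted to nested sets\<close>

text \<open>In base 3 with digits 0 and 1 the first difference cannot be made up: the tail after
  that position sums to at most half of the term there. In base 2 double expansions would
  remain.\<close>

lemma ternary_expansion_inj:
  fixes b b' :: "nat \<Rightarrow> bool"
  assumes eq: "(\<Sum>n. (1/3::real) ^ Suc n * of_bool (b n)) = (\<Sum>n. (1/3) ^ Suc n * of_bool (b' n))"
  shows "b = b'"
proof -
  have summ: "summable (\<lambda>n. (1/3::real) ^ Suc n * of_bool (b n))" for b
    by (rule summable_comparison_test'[where g="\<lambda>n. (1/3) ^ Suc n" and N=0])
      (auto intro!: summable_mult summable_geometric simp: summable_Suc_iff)
  have *: False if bN: "b N" "\<not> b' N" and less: "\<And>n. n < N \<Longrightarrow> b n = b' n"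
    and eq: "(\<Sum>n. (1/3::real) ^ Suc n * of_bool (b n)) = (\<Sum>n. (1/3) ^ Suc n * of_bool (b' n))"
    for b b' N
  proof -
    define P where "P = (\<Sum>n<N. (1/3::real) ^ Suc n * of_bool (b n))"
    have P': "P = (\<Sum>n<N. (1/3::real) ^ Suc n * of_bool (b' n))"
      unfolding P_def using less by (intro sum.cong) auto
    have "P + (1/3) ^ Suc N = (\<Sum>n<Suc N. (1/3::real) ^ Suc n * of_bool (b n))"
      using bN by (simp add: P_def)
    also have "\<dots> \<le> (\<Sum>n. (1/3::real) ^ Suc n * of_bool (b n))"
      by (intro sum_le_suminf summ) auto
    also have "\<dots> = (\<Sum>n. (1/3::real) ^ Suc (n + Suc N) * of_bool (b' (n + Suc N))) + (\<Sum>n<Suc N. (1/3) ^ Suc n * of_bool (b' n))"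
      unfolding eq by (rule suminf_split_initial_segment[OF summ])
    also have "(\<Sum>n<Suc N. (1/3::real) ^ Suc n * of_bool (b' n)) = P"
      using bN by (simp add: P')
    also have "(\<Sum>n. (1/3::real) ^ Suc (n + Suc N) * of_bool (b' (n + Suc N))) \<le> (\<Sum>n. (1/3) ^ (N + 2) * (1/3) ^ n)"
    proof (intro suminf_le)
      show "summable (\<lambda>n. (1/3::real) ^ Suc (n + Suc N) * of_bool (b' (n + Suc N)))"
        using summ[of b'] by (subst summable_iff_shift[of "\<lambda>n. (1/3::real) ^ Suc n * of_bool (b' n)" "Suc N"])
    qed (auto simp: power_add intro!: summable_mult summable_geometric)
    also have "\<dots> = (1/3) ^ (N + 2) * (3/2)"
      by (subst suminf_mult) (auto simp: suminf_geometric intro!: summable_geometric)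
    also have "\<dots> < (1/3) ^ Suc N" by simp
    finally show False by simp
  qed
  show ?thesis
  proof (rule ccontr)
    assume "b \<noteq> b'"
    then have ex: "\<exists>n. b n \<noteq> b' n" by auto
    define N where "N = (LEAST n. b n \<noteq> b' n)"
    have "b N \<noteq> b' N" unfolding N_def using ex by (rule LeastI_ex)
    moreover have "\<And>n. n < N \<Longrightarrow> b n = b' n" unfolding N_def using not_less_Least by blast
    ultimately show False
      using *[of b N b'] *[of b' N b] eq by metis
  qed
qed

text \<open>The probability integral transform: without atoms the distribution function
  \<open>G\<close> of \<open>w\<close> is continuous, so it attains every level in (0,1).\<close>

lemma (in prob_space) cdf_transform_uniform:
  fixes w :: "'a \<Rightarrow> real"
  assumes [measurable]: "w \<in> borel_measurable M"
    and null: "\<And>c. prob {x\<in>space M. w x = c} = 0"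
  defines "U \<equiv> \<lambda>x. prob {y\<in>space M. w y \<le> w x}"
  shows "U \<in> borel_measurable M" "0 < t \<Longrightarrow> t < 1 \<Longrightarrow> prob {x\<in>space M. U x \<le> t} = t"
proof -
  interpret D: real_distribution "distr M borel w" by (rule real_distribution_distr) simp
  define G where "G = cdf (distr M borel w)"
  have G: "G c = prob {y\<in>space M. w y \<le> c}" for c
    unfolding G_def cdf_def by (subst measure_distr) (auto simp: vimage_def Int_def conj_commute)
  have U: "U x = G (w x)" for x by (simp add: U_def G)
  have mono: "G a \<le> G b" if "a \<le> b" for a b
    unfolding G_def using that by (rule D.cdf_nondecreasing)
  then have "mono G" by (rule monoI)
  then have [measurable]: "G \<in> borel_measurable borel" by (rule borel_measurable_mono)
  show [measurable]: "U \<in> borel_measurable M" unfolding U[abs_def] by measurable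
  have "isCont G c" for c
  proof -
    have "measure (distr M borel w) {c} = 0"
      using null[of c] by (subst measure_distr) (auto simp: vimage_def Int_def conj_commute)
    then show ?thesis unfolding G_def by (simp add: D.isCont_cdf)
  qed
  then have cont: "continuous_on A G" for A by (simp add: continuous_at_imp_continuous_on)
  have ex: "\<exists>s. G s = t" if t: "0 < t" "t < 1" for t
  proof -
    have "eventually (\<lambda>s. G s < t) at_bot" "eventually (\<lambda>s. t < G s) at_top"
      unfolding G_def using D.cdf_lim_at_bot D.cdf_lim_at_top_prob t by (auto dest: order_tendstoD)
    then obtain a b where "G a < t" "t < G b"
      by (meson eventually_at_bot_linorder eventually_at_top_linorder order_refl)
    moreover from this have "a \<le> b" using mono[of b a] by linarith
    ultimately show ?thesis using IVT'[of G a t b] cont by auto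
  qed
  assume t: "0 < t" "t < 1"
  show "prob {x\<in>space M. U x \<le> t} = t"
  proof (rule antisym)
    obtain s where s: "G s = t" using ex t by auto
    have "t = prob {x\<in>space M. w x \<le> s}" using s by (simp add: G)
    also have "\<dots> \<le> prob {x\<in>space M. U x \<le> t}"
      using mono s by (intro finite_measure_mono) (auto simp: U)
    finally show "t \<le> prob {x\<in>space M. U x \<le> t}" .
    show "prob {x\<in>space M. U x \<le> t} \<le> t"
    \<comment> \<open>\<open>G\<close> may stay constant at the level \<open>t\<close>, so the upper
      bound goes through levels \<open>t' > t\<close>, for which \<open>G (w x) \<le> t\<close>
      forces \<open>w x \<le> s\<close>.\<close>
    proof (rule dense_ge_bounded[OF t(2)])
      fix t' assume t': "t < t'" "t' < 1"
      then obtain s where s: "G s = t'" using ex[of t'] t by auto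
      have "prob {x\<in>space M. U x \<le> t} \<le> prob {x\<in>space M. w x \<le> s}"
      proof (intro finite_measure_mono subsetI)
        fix x assume "x \<in> {x\<in>space M. U x \<le> t}"
        then show "x \<in> {x\<in>space M. w x \<le> s}"
          using mono[of s "w x"] s t' by (cases "w x \<le> s") (auto simp: U)
      qed simp
      then show "prob {x\<in>space M. U x \<le> t} \<le> t'" using s by (simp add: G)
    qed
  qed
qed

context tree_space
begin

text \<open>
  The witness encodes membership in all sets of the countable tree in base 3, so a fibre lies in a
  single set of every level.
\<close>

lemma ex_null_fibres:
  obtains v :: "'a \<Rightarrow> real" where "v \<in> borel_measurable M" "\<And>x. 0 \<le> v x" "\<And>x. v x < 1"
    "\<And>c. prob {x\<in>space M. v x = c} = 0"
proof
  define e where "e = from_nat_into T"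
  have e: "range e = T" unfolding e_def using countable_T root by (intro range_from_nat_into) auto
  then have [measurable]: "e n \<in> sets M" for n using T_sets by auto
  define v where "v x = (\<Sum>n. (1/3::real) ^ Suc n * of_bool (x \<in> e n))" for x
  show meas [measurable]: "v \<in> borel_measurable M"
    unfolding v_def [abs_def] by measurable
  have summ: "summable (\<lambda>n. (1/3::real) ^ Suc n * of_bool (x \<in> e n))" for x
    by (rule summable_comparison_test'[where g="\<lambda>n. (1/3) ^ Suc n" and N=0])
      (auto intro!: summable_mult summable_geometric simp: summable_Suc_iff)
  show "0 \<le> v x" for x
    unfolding v_def by (intro suminf_nonneg summ) auto
  show "v x < 1" for x
  proof -
    have "v x \<le> (\<Sum>n. (1/3) * (1/3) ^ n)"
      unfolding v_def by (intro suminf_le summ) (auto intro!: summable_mult summable_geometric)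
    also have "\<dots> = 1/2"
      by (subst suminf_mult) (auto simp: suminf_geometric intro!: summable_geometric)
    finally show ?thesis by simp
  qed
  show "prob {x\<in>space M. v x = c} = 0" for c
  proof (cases "{x\<in>space M. v x = c} = {}")
    case False
    then obtain x0 where x0: "x0 \<in> space M" "v x0 = c" by auto
    have "emeasure M {x\<in>space M. v x = c} \<le> (SUP I\<in>tree_level (space M) C m. emeasure M I)" for m
    proof -
      obtain I where I: "I \<in> tree_level (space M) C m" "x0 \<in> I"
        using level_Un[OF root, of m] x0 by auto
      then have "I \<in> T" using level_sub[OF root, of m] by auto
      then obtain n where n: "I = e n" using e by auto
      have "{x\<in>space M. v x = c} \<subseteq> I"
      proof safe
        fix x assume "c = v x"
        then have "(\<lambda>n. x \<in> e n) = (\<lambda>n. x0 \<in> e n)"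
          using x0 by (intro ternary_expansion_inj) (simp add: v_def)
        then show "x \<in> I" using I n by metis
      qed
      then have "emeasure M {x\<in>space M. v x = c} \<le> emeasure M I"
        using \<open>I \<in> T\<close> by (intro emeasure_mono T_meas)
      also have "\<dots> \<le> (SUP I\<in>tree_level (space M) C m. emeasure M I)"
        using I by (intro SUP_upper)
      finally show ?thesis .
    qed
    then have "emeasure M {x\<in>space M. v x = c} \<le> 0"
      using lim by (intro LIMSEQ_le_const) auto
    then show ?thesis by (simp add: measure_def)
  qed (simp del: Collect_empty_eq)
qed

text \<open>
  The witness is the distribution transform of \<open>v - \<kappa>\<close>, where \<open>\<kappa>\<close> counts the sets containing the point
  and \<open>v\<close> has null fibres.
\<close>

lemma ex_uniform_adapted:
  fixes A :: "nat \<Rightarrow> 'a set"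
  assumes A [measurable]: "\<And>n. A n \<in> sets M" and dec: "decseq A" and A0: "A 0 = space M"
    and A_lim: "(\<lambda>n. prob (A n)) \<longlonglongrightarrow> 0"
  obtains U :: "'a \<Rightarrow> real" where "U \<in> borel_measurable M" "\<And>x. 0 \<le> U x"
    "\<And>t. 0 < t \<Longrightarrow> t < 1 \<Longrightarrow> prob {x\<in>space M. U x \<le> t} = t"
    "AE x in M. \<forall>n. x \<in> A n \<longrightarrow> U x \<le> prob (A n)"
proof -
  obtain v :: "'a \<Rightarrow> real" where v [measurable]: "v \<in> borel_measurable M"
    and v01: "\<And>x. 0 \<le> v x" "\<And>x. v x < 1" and v_null: "\<And>c. prob {x\<in>space M. v x = c} = 0"
    using ex_null_fibres by metis
  \<comment> \<open>Because of the shift, \<open>\<kappa> x\<close> is the last index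
    \<open>j\<close> with \<open>x\<close> in \<open>A j\<close>, as \<open>A 0\<close> is the whole
    space. On the null intersection of all \<open>A n\<close> the \<open>LEAST\<close> is an
    unspecified number.\<close>
  define \<kappa> where "\<kappa> x = (LEAST j. x \<notin> A (Suc j))" for x
  have [measurable]: "\<kappa> \<in> measurable M (count_space UNIV)" unfolding \<kappa>_def [abs_def] by measurable
  \<comment> \<open>Since \<open>0 \<le> v x < 1\<close>, the values of \<open>w\<close> on the set
    where \<kappa> equals j lie in [-j, 1 - j): deeper points have smaller \<open>w\<close> and
    hence no larger \<open>U\<close>.\<close>
  define w where "w x = v x - real (\<kappa> x)" for x
  have [measurable]: "w \<in> borel_measurable M" unfolding w_def [abs_def] by measurable
  have \<kappa>A: "x \<in> A j" if "j \<le> \<kappa> x" "x \<in> space M" for x j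
  proof (cases j)
    case (Suc i)
    then show ?thesis using that not_less_Least[of i "\<lambda>j. x \<notin> A (Suc j)"] by (auto simp: \<kappa>_def)
  qed (use that A0 in auto)
  have A\<kappa>: "j \<le> \<kappa> x" if "x \<in> A j" "x \<notin> (\<Inter>n. A n)" for x j
  proof -
    from that(2) obtain i where "x \<notin> A i" by auto
    moreover have "A (Suc i) \<subseteq> A i" using dec by (simp add: decseq_SucD)
    ultimately have "\<exists>i. x \<notin> A (Suc i)" by auto
    then have "x \<notin> A (Suc (\<kappa> x))" unfolding \<kappa>_def by (rule LeastI_ex)
    then have "\<not> Suc (\<kappa> x) \<le> j" using dec that(1) by (auto simp: decseq_def)
    then show ?thesis by simp
  qed
  have w_null: "prob {x\<in>space M. w x = c} = 0" for c
  proof -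
    have "(\<Union>k. {x\<in>space M. v x = c + real k}) \<in> null_sets M"
      using v_null by (intro null_sets_UN) (auto simp: null_sets_def emeasure_eq_measure)
    then have "{x\<in>space M. w x = c} \<in> null_sets M"
      by (rule null_sets_subset) (auto simp: w_def)
    then show ?thesis by (simp add: measure_def null_setsD1)
  qed
  define U where "U x = prob {y\<in>space M. w y \<le> w x}" for x
  have "prob (\<Inter>n. A n) \<le> prob (A n)" for n by (intro finite_measure_mono) auto
  then have "prob (\<Inter>n. A n) \<le> 0" using A_lim by (intro LIMSEQ_le_const) auto
  then have "(\<Inter>n. A n) \<in> null_sets M"
    by (auto simp: null_sets_def emeasure_eq_measure measure_le_0_iff)
  then have AE: "AE x in M. x \<notin> (\<Inter>n. A n)" by (rule AE_not_in)
  show thesis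
  proof
    show "U \<in> borel_measurable M"
      unfolding U_def [abs_def] by (rule cdf_transform_uniform(1)) (auto intro: w_null)
    show "prob {x\<in>space M. U x \<le> t} = t" if "0 < t" "t < 1" for t
      unfolding U_def by (rule cdf_transform_uniform(2)) (auto intro: w_null that)
    show "0 \<le> U x" for x by (simp add: U_def)
    show "AE x in M. \<forall>n. x \<in> A n \<longrightarrow> U x \<le> prob (A n)"
      using AE
    proof eventually_elim
      case (elim x)
      show ?case
      proof (intro allI impI)
        fix n assume "x \<in> A n"
        then have "w x < 1 - real n" using A\<kappa>[OF _ elim] v01[of x] by (force simp: w_def)
        have "{y\<in>space M. w y \<le> w x} \<subseteq> A n"
        proof safe
          fix y assume y: "y \<in> space M" "w y \<le> w x"
          then have "real n < real (\<kappa> y) + 1" using \<open>w x < 1 - real n\<close> v01(1)[of y] by (simp add: w_def)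
          then show "y \<in> A n" using y by (intro \<kappa>A) auto
        qed
        then show "U x \<le> prob (A n)" unfolding U_def by (intro finite_measure_mono A)
      qed
    qed
  qed
qed

end

section \<open>Power profiles concentrated along a tree\<close>

text \<open>Adding the sets one at a time raises the measure of the union by at most \<delta> per
  step, so it cannot jump over the interval from \<open>lo\<close> to
  \<open>lo + \<delta>\<close>.\<close>

lemma finite_subfamily_measure_between:
  assumes "finite_measure M" "finite \<F>" "\<And>K. K \<in> \<F> \<Longrightarrow> K \<in> sets M \<and> measure M K \<le> \<delta>"
    and "lo \<le> measure M (\<Union>\<F>)" and "0 \<le> lo" "0 \<le> \<delta>"
  shows "\<exists>\<G>\<subseteq>\<F>. lo \<le> measure M (\<Union>\<G>) \<and> measure M (\<Union>\<G>) \<le> lo + \<delta>"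
  using assms(2-4)
proof (induction \<F> rule: finite_induct)
  case empty
  then show ?case using assms by (intro exI[of _ "{}"]) auto
next
  case (insert K \<F>)
  interpret finite_measure M by fact
  show ?case
  proof (cases "lo \<le> measure M (\<Union>\<F>)")
    case True
    then obtain \<G> where "\<G> \<subseteq> \<F>" "lo \<le> measure M (\<Union>\<G>)" "measure M (\<Union>\<G>) \<le> lo + \<delta>"
      using insert by auto
    then show ?thesis by blast
  next
    case False
    have "measure M (\<Union>(insert K \<F>)) \<le> measure M K + measure M (\<Union>\<F>)"
      using insert by (auto intro!: measure_Un_le sets.finite_Union)
    also have "\<dots> \<le> lo + \<delta>" using False insert by force
    finally show ?thesis using insert by (intro exI[of _ "insert K \<F>"]) auto
  qed
qed

text \<open>As \<open>0 powr - \<alpha>\<close> is 0, points with \<open>U x = 0\<close> would take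
  the value 0 where the power profile is largest; they have to be discarded.\<close>

lemma (in prob_space) uniform_le_0_null:
  fixes U :: "'a \<Rightarrow> real"
  assumes [measurable]: "U \<in> borel_measurable M"
    and unif: "\<And>t. 0 < t \<Longrightarrow> t < 1 \<Longrightarrow> prob {x\<in>space M. U x \<le> t} = t"
  shows "{x\<in>space M. U x \<le> 0} \<in> null_sets M"
proof -
  have "prob {x\<in>space M. U x \<le> 0} \<le> 0"
  proof (rule dense_ge_bounded[of 0 1])
    fix s :: real assume s: "0 < s" "s < 1"
    have "prob {x\<in>space M. U x \<le> 0} \<le> prob {x\<in>space M. U x \<le> s}"
      using s by (intro finite_measure_mono) auto
    then show "prob {x\<in>space M. U x \<le> 0} \<le> s" using unif[OF s] by simp
  qed simp
  then show ?thesis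
    by (auto simp: null_sets_def emeasure_eq_measure measure_le_0_iff)
qed

lemma (in prob_space) rearrangement_power_transform:
  fixes c \<alpha> :: real
  assumes c: "0 < c" and \<alpha>: "0 \<le> \<alpha>"
    and [measurable]: "U \<in> borel_measurable M" and U0: "\<And>x. 0 \<le> U x"
    and unif: "\<And>t. 0 < t \<Longrightarrow> t < 1 \<Longrightarrow> prob {x\<in>space M. U x \<le> t} = t"
    and t: "0 < t" "t < 1"
  shows "rearrangement M (\<lambda>x. ennreal \<bar>c * U x powr - \<alpha>\<bar>) t = ennreal (c * t powr - \<alpha>)"
proof (rule antisym)
  have anti: "c * b powr - \<alpha> \<le> c * a powr - \<alpha>" if "0 < a" "a \<le> b" for a b
    using that c \<alpha> by (intro mult_left_mono powr_mono2') auto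
  have "{x\<in>space M. ennreal (c * t powr - \<alpha>) < ennreal \<bar>c * U x powr - \<alpha>\<bar>} \<subseteq> {x\<in>space M. U x \<le> t}"
    using anti[of t] c t by (auto simp: ennreal_less_iff abs_mult) (meson less_imp_le not_le)
  then have "emeasure M {x\<in>space M. ennreal (c * t powr - \<alpha>) < ennreal \<bar>c * U x powr - \<alpha>\<bar>}
      \<le> emeasure M {x\<in>space M. U x \<le> t}"
    by (intro emeasure_mono) auto
  also have "\<dots> = ennreal t" using unif[OF t] by (simp add: emeasure_eq_measure)
  finally show "rearrangement M (\<lambda>x. ennreal \<bar>c * U x powr - \<alpha>\<bar>) t \<le> ennreal (c * t powr - \<alpha>)"
    unfolding rearrangement_def by (intro Inf_lower) auto
  have null: "{x\<in>space M. U x \<le> 0} \<in> null_sets M"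
    by (rule uniform_le_0_null) (auto intro: unif)
  show "ennreal (c * t powr - \<alpha>) \<le> rearrangement M (\<lambda>x. ennreal \<bar>c * U x powr - \<alpha>\<bar>) t"
  proof (rule dense_le)
    fix s assume s: "s < ennreal (c * t powr - \<alpha>)"
    \<comment> \<open>\<open>less_rearrangement_iff\<close> asks for a superlevel set of measure
      strictly greater than \<open>t\<close>, hence the passage to some \<open>u > t\<close> by
      continuity.\<close>
    have "((\<lambda>u. ennreal (c * u powr - \<alpha>)) \<longlongrightarrow> ennreal (c * t powr - \<alpha>)) (at_right t)"
      using t by (intro tendsto_ennrealI tendsto_mult tendsto_const tendsto_powr tendsto_ident_at) auto
    from order_tendstoD(1)[OF this s] have "eventually (\<lambda>u. s < ennreal (c * u powr - \<alpha>) \<and> u \<in> {t<..<1}) (at_right t)"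
      using t eventually_at_right_real[of t 1] by (auto intro: eventually_conj)
    then obtain u where u: "s < ennreal (c * u powr - \<alpha>)" "t < u" "u < 1"
      using eventually_happens[of _ "at_right t"] by auto
    have "ennreal t < ennreal u" using u t by (simp add: ennreal_less_iff)
    also have "ennreal u = emeasure M ({x\<in>space M. U x \<le> u} - {x\<in>space M. U x \<le> 0})"
      using unif[of u] u t by (subst emeasure_Diff_null_set[OF null]) (auto simp: emeasure_eq_measure)
    also have "\<dots> \<le> emeasure M {x\<in>space M. s < ennreal \<bar>c * U x powr - \<alpha>\<bar>}"
    proof (intro emeasure_mono subsetI)
      fix x assume x: "x \<in> {x\<in>space M. U x \<le> u} - {x\<in>space M. U x \<le> 0}"
      then have "c * u powr - \<alpha> \<le> c * U x powr - \<alpha>" by (intro anti) auto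
      then have "ennreal (c * u powr - \<alpha>) \<le> ennreal \<bar>c * U x powr - \<alpha>\<bar>" by (intro ennreal_leI) auto
      with u x show "x \<in> {x\<in>space M. s < ennreal \<bar>c * U x powr - \<alpha>\<bar>}" by (auto intro: less_le_trans)
    qed measurable
    finally show "s \<le> rearrangement M (\<lambda>x. ennreal \<bar>c * U x powr - \<alpha>\<bar>) t"
      by (intro less_imp_le) (simp add: less_rearrangement_iff)
  qed
qed

text \<open>Compares the gain of a geometric sequence of sets with \<open>1 / (1 - \<beta>)\<close>,
  the ratio of average to value for t^(-beta), at the price of one factor
  \<open>r powr \<beta>\<close>. Behind it is the weighted mean inequality
  \<open>r powr \<beta> \<le> (1 - \<beta>) + \<beta> * r\<close>.\<close>

lemma geometric_gain:
  fixes r \<beta> :: real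
  assumes "0 < r" "r < 1" "0 \<le> \<beta>" "\<beta> < 1"
  shows "r powr \<beta> / (1 - \<beta>) \<le> (1 - r) / (1 - r powr (1 - \<beta>))"
proof -
  have 1: "r powr (1 - \<beta>) < 1" using powr_less_mono2[of "1 - \<beta>" r 1] assms by simp
  have "r powr \<beta> * r powr (1 - \<beta>) = r" using assms by (simp add: powr_add[symmetric])
  moreover have "r powr \<beta> \<le> (1 - \<beta>) * 1 + \<beta> * r"
    using Youngs_inequality_0[of "1 - \<beta>" \<beta> 1 r] assms by simp
  ultimately have "r powr \<beta> * (1 - r powr (1 - \<beta>)) \<le> (1 - r) * (1 - \<beta>)"
    by (simp add: algebra_simps)
  then show ?thesis using 1 assms by (simp add: field_simps)
qed

context tree_space
begin

lemma prob_pos: "I \<in> T \<Longrightarrow> 0 < prob I"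
  using pos[of I] by (simp add: emeasure_eq_measure)

text \<open>Deep enough below \<open>I\<close> every tree set has measure at most the slack
  \<open>(r2 - r1) * prob I\<close>, while each level still covers \<open>I\<close>; a subfamily of
  suitable size can then be picked.\<close>

lemma ex_descendants_between:
  assumes I: "I \<in> T" and r: "0 < r1" "r1 < r2" "r2 < 1"
  shows "\<exists>\<G>\<subseteq>T. finite \<G> \<and> (\<forall>J\<in>\<G>. J \<subseteq> I) \<and> pairwise (\<lambda>J K. emeasure M (J \<inter> K) = 0) \<G> \<and>
    r1 * prob I \<le> prob (\<Union>\<G>) \<and> prob (\<Union>\<G>) \<le> r2 * prob I"
proof -
  define \<delta> where "\<delta> = (r2 - r1) * prob I"
  have \<delta>: "0 < \<delta>" using r prob_pos[OF I] by (simp add: \<delta>_def)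
  \<comment> \<open>Smallness is given in terms of the depth below the root, so the depth of
    \<open>I\<close> is added to that of its descendants.\<close>
  obtain n where n: "I \<in> tree_level (space M) C n" using I T_eq by blast
  have "eventually (\<lambda>m. (SUP I\<in>tree_level (space M) C m. emeasure M I) < ennreal \<delta>) sequentially"
    using lim \<delta> by (intro order_tendstoD) auto
  then obtain m where "\<forall>k\<ge>m. (SUP I\<in>tree_level (space M) C k. emeasure M I) < ennreal \<delta>"
    unfolding eventually_sequentially by blast
  then have m: "(SUP I\<in>tree_level (space M) C (n + m). emeasure M I) < ennreal \<delta>"
    by simp
  let ?F = "tree_level I C m"
  have small: "K \<in> sets M \<and> prob K \<le> \<delta>" if K: "K \<in> ?F" for K
  proof
    show "K \<in> sets M" using K level_sub[OF I, of m] by auto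
    have "K \<in> tree_level (space M) C (n + m)" using level_add n K by blast
    then have "emeasure M K \<le> (SUP I\<in>tree_level (space M) C (n + m). emeasure M I)"
      by (rule SUP_upper)
    with m have "emeasure M K < ennreal \<delta>" by (rule le_less_trans[rotated])
    then show "prob K \<le> \<delta>" by (simp add: emeasure_eq_measure ennreal_less_iff)
  qed
  have "r1 * prob I \<le> 1 * prob I" using r by (intro mult_right_mono) auto
  then have "\<exists>\<G>\<subseteq>?F. r1 * prob I \<le> prob (\<Union>\<G>) \<and> prob (\<Union>\<G>) \<le> r1 * prob I + \<delta>"
    using small \<delta> r level_Un[OF I, of m]
    by (intro finite_subfamily_measure_between level_fin I finite_measure_axioms) auto
  then obtain \<G> where \<G>: "\<G> \<subseteq> ?F" "r1 * prob I \<le> prob (\<Union>\<G>)" "prob (\<Union>\<G>) \<le> r1 * prob I + \<delta>"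
    by blast
  show ?thesis
  proof (intro exI[of _ \<G>] conjI ballI)
    show "\<G> \<subseteq> T" using \<G>(1) level_sub[OF I] by (rule subset_trans)
    show "finite \<G>" using \<G>(1) level_fin[OF I] by (rule finite_subset)
    show "pairwise (\<lambda>J K. emeasure M (J \<inter> K) = 0) \<G>"
      using level_ad[OF I] \<G>(1) by (rule pairwise_subset)
    show "J \<subseteq> I" if "J \<in> \<G>" for J using that \<G>(1) level_le[OF I] by auto
    show "prob (\<Union>\<G>) \<le> r2 * prob I" using \<G>(3) by (simp add: \<delta>_def algebra_simps)
  qed (fact \<G>)
qed

text \<open>
  \<open>S\<close> selects almost disjoint descendants of \<open>I\<close> occupying a proportion between \<open>r\<close> and \<open>r powr \<theta>\<close> of \<open>I\<close>, and \<open>A n\<close>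
  is the union of the \<open>n\<close>-th generation. On \<open>A n\<close> the function \<open>\<phi> = c U powr -\<alpha>\<close> is at least \<open>c \<rho> ^ n\<close>, and
  each set of generation \<open>k\<close> meets \<open>A (k + i)\<close> in a proportion at least \<open>r ^ i\<close>; summing the geometric series
  bounds the averages of \<open>\<phi>\<close> over these tree sets, hence the maximal function on \<open>A k\<close>, from below.
\<close>

lemma ex_power_profile:
  assumes c: "0 < c" and \<alpha>: "0 \<le> \<alpha>" "\<alpha> < 1" and r: "0 < r" "r < 1" and \<theta>: "0 < \<theta>" "\<theta> < 1"
  obtains \<phi> :: "'a \<Rightarrow> real" where "\<phi> \<in> borel_measurable M" "\<And>x. 0 \<le> \<phi> x"
    "\<And>t. 0 < t \<Longrightarrow> t < 1 \<Longrightarrow> rearrangement M (\<lambda>x. ennreal \<bar>\<phi> x\<bar>) t = ennreal (c * t powr - \<alpha>)"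
    "\<And>t. 0 < t \<Longrightarrow> t < 1 \<Longrightarrow> ennreal (c * r powr (2 * (\<alpha> * \<theta>)) / (1 - \<alpha> * \<theta>) * t powr - (\<alpha> * \<theta>))
      \<le> rearrangement M (tree_maximal M T \<phi>) t"
proof -
  define \<beta> where "\<beta> = \<alpha> * \<theta>"
  have "\<alpha> * \<theta> \<le> \<alpha> * 1" using \<alpha> \<theta> by (intro mult_left_mono) auto
  then have \<beta>: "0 \<le> \<beta>" "\<beta> < 1" using \<alpha> \<theta> by (auto simp: \<beta>_def)
  \<comment> \<open>With the bounds r^n and (r^theta)^n for the size of generation \<open>n\<close>,
    the uncertainty is one of exponent only; this is the origin of \<beta> = \<alpha> *
    \<theta>.\<close>
  define r2 where "r2 = r powr \<theta>"
  have r2: "r < r2" "r2 < 1" "0 < r2"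
    using r \<theta> powr_less_mono'[of r \<theta> 1] powr_less_mono2[of \<theta> r 1] by (auto simp: r2_def)
  define good where "good I \<G> \<longleftrightarrow> \<G> \<subseteq> T \<and> finite \<G> \<and> (\<forall>J\<in>\<G>. J \<subseteq> I) \<and> pairwise (\<lambda>J K. emeasure M (J \<inter> K) = 0) \<G> \<and>
    r * prob I \<le> prob (\<Union>\<G>) \<and> prob (\<Union>\<G>) \<le> r2 * prob I" for I \<G>
  have "\<exists>\<G>. good I \<G>" if "I \<in> T" for I
    using ex_descendants_between[OF that r(1) r2(1,2)] unfolding good_def by blast
  then obtain S where "\<And>I. I \<in> T \<Longrightarrow> good I (S I)" by metis
  note S = this[unfolded good_def]
  interpret D: descent M T S
  proof
    show "J \<subseteq> I" if "I \<in> T" "J \<in> S I" for I J using S[OF that(1)] that(2) by blast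
  qed (simp_all add: S T_sets)
  define A where "A n = \<Union>(tree_level (space M) S n)" for n
  have A_bounds: "r ^ n \<le> prob (A n)" "prob (A n) \<le> r2 ^ n" for n
    using D.measure_level_bounds[OF root, of r r2 n] S r r2 by (auto simp: A_def prob_space)
  have dec: "\<Union>(tree_level I S (Suc n)) \<subseteq> \<Union>(tree_level I S n)" if "I \<in> T" for I n
  proof safe
    fix x J assume "x \<in> J" "J \<in> tree_level I S (Suc n)"
    then obtain K where K: "K \<in> tree_level I S n" "J \<in> S K" "x \<in> J" by auto
    then have "J \<subseteq> K" using D.level_sub[OF that, of n] by (intro D.S_le) auto
    with K show "x \<in> \<Union>(tree_level I S n)" by blast
  qed
  have A_sets [measurable]: "A n \<in> sets M" for n unfolding A_def by (rule D.level_Union_sets[OF root])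
  have A_lim: "(\<lambda>n. prob (A n)) \<longlonglongrightarrow> 0"
  proof (rule tendsto_sandwich[OF _ _ tendsto_const])
    show "(\<lambda>n. r2 ^ n) \<longlonglongrightarrow> 0" using r2 by (intro LIMSEQ_power_zero) auto
  qed (auto simp: A_bounds)
  have A_dec: "decseq A" unfolding A_def by (intro decseq_SucI dec root)
  have A_0: "A 0 = space M" by (simp add: A_def)
  obtain U :: "'a \<Rightarrow> real" where U [measurable]: "U \<in> borel_measurable M" and U0: "\<And>x. 0 \<le> U x"
    and unif: "\<And>t. 0 < t \<Longrightarrow> t < 1 \<Longrightarrow> prob {x\<in>space M. U x \<le> t} = t"
    and UA: "AE x in M. \<forall>n. x \<in> A n \<longrightarrow> U x \<le> prob (A n)"
    using ex_uniform_adapted[OF A_sets A_dec A_0 A_lim] by blast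
  have "{x\<in>space M. U x \<le> 0} \<in> null_sets M"
    by (rule uniform_le_0_null[OF U unif])
  then have U_pos: "AE x in M. 0 < U x"
    by (rule AE_I') auto
  define \<phi> where "\<phi> x = c * U x powr - \<alpha>" for x
  have [measurable]: "\<phi> \<in> borel_measurable M" unfolding \<phi>_def [abs_def] by measurable
  have \<phi>0: "0 \<le> \<phi> x" for x using c by (simp add: \<phi>_def)
  \<comment> \<open>The factor by which the lower bound for \<phi> grows per generation.\<close>
  define \<rho> where "\<rho> = r2 powr - \<alpha>"
  have \<rho>_r: "\<rho> = r powr - \<beta>" by (simp add: \<rho>_def r2_def \<beta>_def powr_powr mult.commute)
  have \<rho>1: "1 \<le> \<rho>" using r2 \<alpha> powr_mono2'[of "- \<alpha>" r2 1] by (simp add: \<rho>_def)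
  have \<phi>A: "AE x in M. \<forall>n. x \<in> A n \<longrightarrow> c * \<rho> ^ n \<le> \<phi> x"
    using UA U_pos
  proof eventually_elim
    case (elim x)
    show ?case
    proof (intro allI impI)
      fix n assume "x \<in> A n"
      with elim have "U x \<le> r2 ^ n" using A_bounds(2)[of n] by (metis order_trans)
      then have "(r2 ^ n) powr - \<alpha> \<le> U x powr - \<alpha>" using elim \<alpha> by (intro powr_mono2') auto
      also have "(r2 ^ n) powr - \<alpha> = \<rho> ^ n"
        using r2 by (simp add: \<rho>_def powr_powr mult.commute flip: powr_realpow)
      finally show "c * \<rho> ^ n \<le> \<phi> x" using c by (simp add: \<phi>_def)
    qed
  qed
  \<comment> \<open>The closed form of \<open>1 + (\<rho> - 1) * r * (1 / (1 - \<rho> * r))\<close>,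
    the limit of the geometric sums below.\<close>
  define L where "L = (1 - r) / (1 - \<rho> * r)"
  have \<rho>r: "\<rho> * r = r powr (1 - \<beta>)" using r by (simp add: \<rho>_r powr_diff powr_minus_divide)
  then have \<rho>r1: "0 < \<rho> * r" "\<rho> * r < 1" using r \<beta> powr_less_mono2[of "1 - \<beta>" r 1] by auto
  have L_ge: "r powr \<beta> / (1 - \<beta>) \<le> L" unfolding L_def \<rho>r by (rule geometric_gain[OF r \<beta>])
  have avg: "ennreal (c * \<rho> ^ k * L * prob I) \<le> (\<integral>\<^sup>+x\<in>I. ennreal \<bar>\<phi> x\<bar> \<partial>M)"
    if I: "I \<in> tree_level (space M) S k" for I k
  proof -
    have IT: "I \<in> T" using I D.level_sub[OF root] by auto
    define B where "B i = \<Union>(tree_level I S i)" for i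
    have [measurable]: "B i \<in> sets M" for i unfolding B_def by (rule D.level_Union_sets[OF IT])
    have BA: "B i \<subseteq> A (k + i)" for i using I by (auto simp: A_def B_def D.level_add)
    have BI: "B i \<subseteq> I" for i unfolding B_def using D.level_le[OF IT] by blast
    have B_bound: "r ^ i * prob I \<le> prob (B i)" for i
      using D.measure_level_bounds[OF IT, of r r2 i] S r r2 by (auto simp: B_def)
    \<comment> \<open>A step function below \<phi> on \<open>I\<close>, written by its increments
      over the nested sets \<open>B i\<close>, so that its integral involves only their measures,
      for which lower bounds are at hand.\<close>
    define P where "P N x = c * \<rho> ^ k * indicator I x + (\<Sum>i<N. c * \<rho> ^ (k + i) * (\<rho> - 1) * indicator (B (Suc i)) x)" for N x
    have P_le: "P N x \<le> c * \<rho> ^ (k + N)" for N x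
    proof (induction N)
      case 0
      then show ?case using c \<rho>1 by (auto simp: P_def indicator_def)
    next
      case (Suc N)
      have "P (Suc N) x = P N x + c * \<rho> ^ (k + N) * (\<rho> - 1) * indicator (B (Suc N)) x" by (simp add: P_def)
      also have "\<dots> \<le> c * \<rho> ^ (k + N) + c * \<rho> ^ (k + N) * (\<rho> - 1)"
        using c \<rho>1 by (intro add_mono Suc) (auto simp: indicator_def)
      also have "\<dots> = c * \<rho> ^ (k + Suc N)" by (simp add: algebra_simps)
      finally show ?case .
    qed
    have P_\<phi>: "AE x in M. P N x \<le> \<phi> x * indicator I x" for N
      using \<phi>A
    proof eventually_elim
      case (elim x)
      show ?case
      proof (cases "x \<in> I")
        case True
        have "P N x \<le> \<phi> x"
        proof (induction N)
          case 0
          then show ?case using elim[rule_format, of k] True I by (auto simp: P_def A_def)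
        next
          case (Suc N)
          show ?case
          proof (cases "x \<in> B (Suc N)")
            case True
            then have "c * \<rho> ^ (k + Suc N) \<le> \<phi> x" using elim BA by blast
            with P_le[of "Suc N" x] show ?thesis by linarith
          next
            case False
            then have "P (Suc N) x = P N x" by (simp add: P_def)
            with Suc show ?thesis by simp
          qed
        qed
        with True show ?thesis by simp
      next
        case False
        then have "x \<notin> B i" for i using BI by blast
        with False show ?thesis by (simp add: P_def)
      qed
    qed
    have P_int: "(\<integral>\<^sup>+x. ennreal (P N x) \<partial>M) = ennreal (c * \<rho> ^ k * prob I + (\<Sum>i<N. c * \<rho> ^ (k + i) * (\<rho> - 1) * prob (B (Suc i))))" for N
    proof -
      have ind: "integrable M (\<lambda>x. a * indicator E x)" "(\<integral>x. a * indicator E x \<partial>M) = a * prob E"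
        if "E \<in> sets M" for a :: real and E
        using that by (simp_all add: less_top[symmetric])
      have [measurable]: "I \<in> sets M" using IT by (rule T_meas)
      have P_nn: "0 \<le> P N x" for x
        unfolding P_def using c \<rho>1 by (intro add_nonneg_nonneg sum_nonneg mult_nonneg_nonneg) auto
      have "integrable M (P N)"
        unfolding P_def [abs_def] by (intro Bochner_Integration.integrable_add Bochner_Integration.integrable_sum ind) measurable
      then have "(\<integral>\<^sup>+x. ennreal (P N x) \<partial>M) = ennreal (\<integral>x. P N x \<partial>M)"
        using P_nn by (intro nn_integral_eq_integral) auto
      also have "(\<integral>x. P N x \<partial>M) = (\<integral>x. c * \<rho> ^ k * indicator I x \<partial>M)
          + (\<integral>x. (\<Sum>i<N. c * \<rho> ^ (k + i) * (\<rho> - 1) * indicator (B (Suc i)) x) \<partial>M)"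
        unfolding P_def by (intro Bochner_Integration.integral_add Bochner_Integration.integrable_sum ind) measurable
      also have "(\<integral>x. (\<Sum>i<N. c * \<rho> ^ (k + i) * (\<rho> - 1) * indicator (B (Suc i)) x) \<partial>M)
          = (\<Sum>i<N. \<integral>x. c * \<rho> ^ (k + i) * (\<rho> - 1) * indicator (B (Suc i)) x \<partial>M)"
        by (intro Bochner_Integration.integral_sum ind) measurable
      also have "(\<integral>x. c * \<rho> ^ k * indicator I x \<partial>M) = c * \<rho> ^ k * prob I"
        by (intro ind) measurable
      also have "(\<Sum>i<N. \<integral>x. c * \<rho> ^ (k + i) * (\<rho> - 1) * indicator (B (Suc i)) x \<partial>M)
          = (\<Sum>i<N. c * \<rho> ^ (k + i) * (\<rho> - 1) * prob (B (Suc i)))"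
        by (intro sum.cong refl ind) measurable
      finally show ?thesis .
    qed
    have step: "c * \<rho> ^ k * prob I * (1 + (\<rho> - 1) * r * (\<Sum>i<N. (\<rho> * r) ^ i))
      \<le> c * \<rho> ^ k * prob I + (\<Sum>i<N. c * \<rho> ^ (k + i) * (\<rho> - 1) * prob (B (Suc i)))" for N
    proof -
      have "c * \<rho> ^ k * prob I * (1 + (\<rho> - 1) * r * (\<Sum>i<N. (\<rho> * r) ^ i))
        = c * \<rho> ^ k * prob I + (\<Sum>i<N. c * \<rho> ^ (k + i) * (\<rho> - 1) * (r ^ Suc i * prob I))"
        by (simp add: distrib_left sum_distrib_left power_add power_mult_distrib mult_ac)
      also have "\<dots> \<le> c * \<rho> ^ k * prob I + (\<Sum>i<N. c * \<rho> ^ (k + i) * (\<rho> - 1) * prob (B (Suc i)))"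
        using c \<rho>1 by (intro add_left_mono sum_mono mult_left_mono B_bound) auto
      finally show ?thesis .
    qed
    have "(\<lambda>N. ennreal (c * \<rho> ^ k * prob I * (1 + (\<rho> - 1) * r * (\<Sum>i<N. (\<rho> * r) ^ i))))
      \<longlonglongrightarrow> ennreal (c * \<rho> ^ k * prob I * (1 + (\<rho> - 1) * r * (1 / (1 - \<rho> * r))))"
      using geometric_sums[of "\<rho> * r"] \<rho>r1
      by (intro tendsto_ennrealI tendsto_intros) (auto simp: sums_def)
    moreover have "1 + (\<rho> - 1) * r * (1 / (1 - \<rho> * r)) = L"
      using \<rho>r1 by (simp add: L_def field_simps)
    ultimately have lim: "(\<lambda>N. ennreal (c * \<rho> ^ k * prob I * (1 + (\<rho> - 1) * r * (\<Sum>i<N. (\<rho> * r) ^ i))))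
      \<longlonglongrightarrow> ennreal (c * \<rho> ^ k * L * prob I)"
      by (simp add: mult_ac)
    show ?thesis
    proof (rule LIMSEQ_le_const2[OF lim], intro exI allI impI)
      fix N
      have "ennreal (c * \<rho> ^ k * prob I * (1 + (\<rho> - 1) * r * (\<Sum>i<N. (\<rho> * r) ^ i))) \<le> (\<integral>\<^sup>+x. ennreal (P N x) \<partial>M)"
        unfolding P_int by (intro ennreal_leI step)
      also have "\<dots> \<le> (\<integral>\<^sup>+x\<in>I. ennreal \<bar>\<phi> x\<bar> \<partial>M)"
      proof (rule nn_integral_mono_AE)
        show "AE x in M. ennreal (P N x) \<le> ennreal \<bar>\<phi> x\<bar> * indicator I x"
          using P_\<phi>[of N] by eventually_elim (use \<phi>0 in \<open>auto simp: indicator_def ennreal_neg intro: ennreal_leI\<close>)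
      qed
      finally show "ennreal (c * \<rho> ^ k * prob I * (1 + (\<rho> - 1) * r * (\<Sum>i<N. (\<rho> * r) ^ i)))
          \<le> (\<integral>\<^sup>+x\<in>I. ennreal \<bar>\<phi> x\<bar> \<partial>M)" .
    qed
  qed
  have L0: "0 \<le> L" using r \<rho>r1 by (simp add: L_def)
  have max_ge: "ennreal (c * \<rho> ^ k * L) \<le> tree_maximal M T \<phi> x" if x: "x \<in> A k" for x k
  proof -
    obtain I where I: "I \<in> tree_level (space M) S k" "x \<in> I" using x by (auto simp: A_def)
    then have IT: "I \<in> T" using D.level_sub[OF root] by auto
    have "ennreal (c * \<rho> ^ k * L) = ennreal (c * \<rho> ^ k * L * prob I) / emeasure M I"
      using prob_pos[OF IT] c \<rho>1 L0 by (simp add: emeasure_eq_measure divide_ennreal)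
    also have "\<dots> \<le> (\<integral>\<^sup>+x\<in>I. ennreal \<bar>\<phi> x\<bar> \<partial>M) / emeasure M I"
      by (intro divide_right_mono_ennreal avg I)
    also have "\<dots> \<le> tree_maximal M T \<phi> x"
      unfolding tree_maximal_def using I IT by (intro SUP_upper) auto
    finally show ?thesis .
  qed
  have rearr_ge: "ennreal (c * \<rho> ^ k * L) \<le> rearrangement M (tree_maximal M T \<phi>) t"
    if t: "0 < t" "t < r ^ k" for t k
  proof (rule dense_le)
    fix s assume s: "s < ennreal (c * \<rho> ^ k * L)"
    have "ennreal t < emeasure M (A k)"
      using t A_bounds(1)[of k] by (simp add: emeasure_eq_measure ennreal_less_iff)
    also have "\<dots> \<le> emeasure M {x\<in>space M. s < tree_maximal M T \<phi> x}"
      using s max_ge sets.sets_into_space[OF A_sets[of k]] by (intro emeasure_mono) (auto intro: less_le_trans)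
    finally show "s \<le> rearrangement M (tree_maximal M T \<phi>) t"
      by (intro less_imp_le) (simp add: less_rearrangement_iff)
  qed
  show thesis
  proof
    show "\<phi> \<in> borel_measurable M" "\<And>x. 0 \<le> \<phi> x" by (fact, rule \<phi>0)
    show "rearrangement M (\<lambda>x. ennreal \<bar>\<phi> x\<bar>) t = ennreal (c * t powr - \<alpha>)" if "0 < t" "t < 1" for t
      unfolding \<phi>_def using that c \<alpha> by (intro rearrangement_power_transform U U0 unif) auto
    show "ennreal (c * r powr (2 * (\<alpha> * \<theta>)) / (1 - \<alpha> * \<theta>) * t powr - (\<alpha> * \<theta>))
      \<le> rearrangement M (tree_maximal M T \<phi>) t" if t: "0 < t" "t < 1" for t
    proof -
      have "\<exists>n. r ^ n \<le> t"
        using real_arch_pow_inv[OF t(1) r(2)] by (auto intro: less_imp_le)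
      \<comment> \<open>Thus \<open>t\<close> lies in [r^(k+1), r^k). Passing from the profile at
        \<open>t\<close> to generation \<open>k\<close> costs one factor
        \<open>r powr \<beta>\<close>, and \<open>geometric_gain\<close> costs another, whence the
        exponent \<open>2 * \<beta>\<close>.\<close>
      define n where "n = (LEAST n. r ^ n \<le> t)"
      have n: "r ^ n \<le> t" unfolding n_def by (rule LeastI_ex) fact
      moreover have "n \<noteq> 0" using n t by (cases n) auto
      then obtain k where k: "n = Suc k" by (cases n) auto
      then have tk: "t < r ^ k" using not_less_Least[of k "\<lambda>n. r ^ n \<le> t"] by (simp add: n_def)
      have "(r ^ n) powr - \<beta> = \<rho> ^ n"
        using r by (simp add: \<rho>_r powr_powr mult.commute flip: powr_realpow)
      moreover have "t powr - \<beta> \<le> (r ^ n) powr - \<beta>" using n r \<beta> by (intro powr_mono2') auto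
      ultimately have "t powr - \<beta> \<le> \<rho> ^ n" by simp
      then have "r powr \<beta> * t powr - \<beta> \<le> r powr \<beta> * \<rho> ^ n" by (intro mult_left_mono) auto
      also have "\<dots> = \<rho> ^ k" using r by (simp add: k \<rho>_r powr_minus)
      finally have 1: "r powr \<beta> * t powr - \<beta> \<le> \<rho> ^ k" .
      have "c * r powr (2 * \<beta>) / (1 - \<beta>) * t powr - \<beta> = c * (r powr \<beta> * t powr - \<beta>) * (r powr \<beta> / (1 - \<beta>))"
      proof -
        have "r powr (2 * \<beta>) = r powr \<beta> * r powr \<beta>" by (subst powr_add[symmetric]) simp
        then show ?thesis by simp
      qed
      also have "\<dots> \<le> c * \<rho> ^ k * L"
      proof (rule mult_mono[OF _ L_ge])
        show "c * (r powr \<beta> * t powr - \<beta>) \<le> c * \<rho> ^ k" using 1 c by (intro mult_left_mono) auto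
      qed (use c \<beta> \<rho>1 in auto)
      finally have "ennreal (c * r powr (2 * \<beta>) / (1 - \<beta>) * t powr - \<beta>) \<le> ennreal (c * \<rho> ^ k * L)"
        by (rule ennreal_leI)
      also have "\<dots> \<le> rearrangement M (tree_maximal M T \<phi>) t"
        using t tk by (intro rearr_ge)
      finally show ?thesis by (simp add: \<beta>_def)
    qed
  qed
qed

end

section \<open>The Bellman function\<close>

text \<open>The bijection \<open>bij_betw_bellman_H\<close> gives no direction, and
  \<open>bellman_le\<close> compares \<open>z\<close> with points to its right that may lie beyond
  \<open>conj_exp q\<close>.\<close>

lemma bellman_H_strict_antimono:
  assumes "1 < q" "1 \<le> x" "x < y"
  shows "bellman_H q y < bellman_H q x"
proof (rule DERIV_neg_imp_decreasing_open[OF assms(3)])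
  show "continuous_on {x..y} (bellman_H q)"
    unfolding bellman_H_def using assms by (intro continuous_intros) auto
  fix z assume z: "x < z" "z < y"
  have "((bellman_H q) has_real_derivative q * (q - 1) * (z powr (q - 2) - z powr (q - 1))) (at z)"
    unfolding bellman_H_def [abs_def] using assms z by (auto intro!: derivative_eq_intros simp: algebra_simps)
  moreover have "z powr (q - 2) < z powr (q - 1)" using assms z by simp
  then have "q * (q - 1) * (z powr (q - 2) - z powr (q - 1)) < 0"
    using assms by (intro mult_pos_neg) auto
  ultimately show "\<exists>d. (bellman_H q has_real_derivative d) (at z) \<and> d < 0" by blast
qed

text \<open>With k = p'/q' one has \<open>q * (1 - 1 / p) * k = q - 1\<close>, so the substitution
  \<open>x = k * z\<close> turns the expression from \<open>weighted_average_le\<close> into a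
  multiple of \<open>bellman_H q z\<close>.\<close>

lemma bellman_H_scale:
  assumes "1 < p" "1 < q" "0 < z"
  shows "(conj_exp p / conj_exp q) powr (q - 1) * bellman_H q z =
    q * (conj_exp p / conj_exp q * z) powr (q - 1) - q * (1 - 1 / p) * (conj_exp p / conj_exp q * z) powr q"
proof -
  define k where "k = conj_exp p / conj_exp q"
  have k: "0 < k" using assms by (simp add: k_def conj_exp_def)
  have "q * (1 - 1 / p) * k = q - 1"
    using assms by (simp add: k_def conj_exp_def field_simps)
  moreover have "k powr q = k * k powr (q - 1)" using k by (simp add: powr_diff)
  ultimately have "q * (1 - 1 / p) * (k * z) powr q = (q - 1) * k powr (q - 1) * z powr q"
    using k assms by (simp add: powr_mult mult.assoc[symmetric])
  then show ?thesis
    using k assms unfolding k_def[symmetric] by (simp add: bellman_H_def powr_mult algebra_simps)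
qed

lemma nn_integral_lorentz_power:
  assumes "0 < p" "0 < q" "0 \<le> K" "\<beta> < 1 / p"
  shows "(\<integral>\<^sup>+t\<in>{0<..1}. ennreal (t powr (q / p - 1) * (K * t powr - \<beta>) powr q) \<partial>lborel) = ennreal (K powr q / (q / p - \<beta> * q))"
proof -
  have "q * \<beta> < q * (1 / p)" using assms by (intro mult_strict_left_mono) auto
  then have pos: "0 < q / p - \<beta> * q" by (simp add: mult.commute)
  have "(\<integral>\<^sup>+t\<in>{0<..1}. ennreal (t powr (q / p - 1) * (K * t powr - \<beta>) powr q) \<partial>lborel)
    = (\<integral>\<^sup>+t. ennreal (K powr q) * (ennreal (t powr (q / p - 1 - \<beta> * q)) * indicator {0<..1} t) \<partial>lborel)"
  proof (intro nn_integral_cong)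
    fix t :: real
    have "t powr (q / p - 1) * (K * t powr - \<beta>) powr q = K powr q * t powr (q / p - 1 - \<beta> * q)"
      using assms by (simp add: powr_mult powr_powr powr_add[symmetric] mult.left_commute[of _ "K powr q"])
    then show "ennreal (t powr (q / p - 1) * (K * t powr - \<beta>) powr q) * indicator {0<..1} t
      = ennreal (K powr q) * (ennreal (t powr (q / p - 1 - \<beta> * q)) * indicator {0<..1} t)"
      by (simp add: ennreal_mult mult.assoc)
  qed
  also have "\<dots> = ennreal (K powr q) * ennreal (1 powr (q / p - 1 - \<beta> * q + 1) / (q / p - 1 - \<beta> * q + 1))"
    using pos by (subst nn_integral_cmult) (simp, subst nn_integral_powr_0, auto)
  also have "\<dots> = ennreal (K powr q / (q / p - \<beta> * q))"
    using pos by (simp add: ennreal_mult'[symmetric])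
  finally show ?thesis .
qed

context tree_space
begin

text \<open>
  With \<open>x\<close> the ratio of the averages \<open>\<Phi> t / t\<close> to \<open>g t\<close>, equality in the Hardy-type inequality holds
  for \<open>g t = f / x * t powr (1/x - 1)\<close>; this is non-increasing because \<open>1 \<le> x\<close>.
\<close>

lemma bellman_ge:
  assumes pq: "1 < p" "1 < q" and Ff: "0 < F" "0 < f" and x: "1 \<le> x" "x < conj_exp p"
    and f: "f powr q = F * (q * x powr (q - 1) - q * (1 - 1 / p) * x powr q)"
  shows "bellman_admissible M p q F f \<noteq> {}" "ennreal (x powr q * F) \<le> bellman M T p q F f"
proof -
  define c where "c = f / x"
  define \<alpha> where "\<alpha> = 1 - 1 / x"
  have c: "0 < c" using x Ff by (simp add: c_def)
  have \<alpha>: "0 \<le> \<alpha>" "\<alpha> < 1" using x by (auto simp: \<alpha>_def)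
  \<comment> \<open>The bound \<open>x < conj_exp p\<close> amounts to
    \<open>\<alpha> < 1 / p\<close>, which makes the Lorentz integral of the power profile
    finite.\<close>
  have "1 / conj_exp p < 1 / x" using x pq by (intro divide_strict_left_mono mult_pos_pos) (auto simp: conj_exp_def)
  then have \<alpha>p: "\<alpha> < 1 / p" using pq by (simp add: \<alpha>_def conj_exp_def field_simps)
  have "q * \<alpha> < q * (1 / p)" using pq \<alpha>p by (intro mult_strict_left_mono) auto
  then have pos: "0 < q / p - \<alpha> * q" by (simp add: mult.commute)
  have "f powr q = F * x powr q * (q / p - \<alpha> * q)"
    using x unfolding f by (simp add: \<alpha>_def powr_diff algebra_simps)
  then have cF: "c powr q / (q / p - \<alpha> * q) = F"
    using x pos Ff by (simp add: c_def powr_divide)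
  have cf: "c / (1 - \<alpha>) = f" using x by (simp add: c_def \<alpha>_def)
  \<comment> \<open>The constant of \<open>ex_power_profile\<close> with
    \<open>r = \<theta>\<close>, so that a single limit removes both losses.\<close>
  define K where "K \<theta> = c * \<theta> powr (2 * (\<alpha> * \<theta>)) / (1 - \<alpha> * \<theta>)" for \<theta>
  have main: "bellman_admissible M p q F f \<noteq> {} \<and> ennreal (K \<theta> powr q / (q / p - \<alpha> * \<theta> * q)) \<le> bellman M T p q F f"
    if \<theta>: "0 < \<theta>" "\<theta> < 1" for \<theta>
  proof -
    have "\<alpha> * \<theta> \<le> \<alpha> * 1" using \<alpha> \<theta> by (intro mult_left_mono) auto
    then have \<beta>: "\<alpha> * \<theta> < 1 / p" "\<alpha> * \<theta> < 1" using \<alpha> \<alpha>p by auto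
    have K: "0 \<le> K \<theta>" using c \<beta> by (simp add: K_def)
    obtain \<phi> :: "'a \<Rightarrow> real" where \<phi> [measurable]: "\<phi> \<in> borel_measurable M" and \<phi>0: "\<And>x. 0 \<le> \<phi> x"
      and r: "\<And>t. 0 < t \<Longrightarrow> t < 1 \<Longrightarrow> rearrangement M (\<lambda>x. ennreal \<bar>\<phi> x\<bar>) t = ennreal (c * t powr - \<alpha>)"
      and R: "\<And>t. 0 < t \<Longrightarrow> t < 1 \<Longrightarrow> ennreal (K \<theta> * t powr - (\<alpha> * \<theta>)) \<le> rearrangement M (tree_maximal M T \<phi>) t"
      using ex_power_profile[OF c \<alpha> \<theta> \<theta>] unfolding K_def by blast
    have "(\<integral>\<^sup>+x. ennreal \<bar>\<phi> x\<bar> \<partial>M) = (\<integral>\<^sup>+t\<in>{0<..1}. rearrangement M (\<lambda>x. ennreal \<bar>\<phi> x\<bar>) t \<partial>lborel)"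
      by (rule nn_integral_rearrangement[OF prob_space_axioms, of "\<lambda>x. ennreal \<bar>\<phi> x\<bar>" "\<lambda>y. y"]) auto
    also have "\<dots> = (\<integral>\<^sup>+t. ennreal c * (ennreal (t powr - \<alpha>) * indicator {0<..1} t) \<partial>lborel)"
    proof (rule nn_integral_cong_AE)
      show "AE t in lborel. rearrangement M (\<lambda>x. ennreal \<bar>\<phi> x\<bar>) t * indicator {0<..1} t
          = ennreal c * (ennreal (t powr - \<alpha>) * indicator {0<..1} t)"
        using AE_lborel_singleton[of 1]
        by eventually_elim (use c in \<open>auto simp: indicator_def r ennreal_mult\<close>)
    qed
    also have "\<dots> = ennreal c * ennreal (1 powr (- \<alpha> + 1) / (- \<alpha> + 1))"
      using \<alpha> by (subst nn_integral_cmult) (simp, subst nn_integral_powr_0, auto)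
    also have "\<dots> = ennreal f" using c \<alpha> cf by (simp add: ennreal_mult'[symmetric])
    finally have mass: "(\<integral>\<^sup>+x. ennreal \<bar>\<phi> x\<bar> \<partial>M) = ennreal f" .
    have "ennpowr (lorentz_norm M p q (\<lambda>x. ennreal \<bar>\<phi> x\<bar>)) q
        = (\<integral>\<^sup>+t\<in>{0<..1}. ennreal (t powr (q / p - 1) * (c * t powr - \<alpha>) powr q) \<partial>lborel)"
      using pq c by (intro antisym lorentz_norm_le lorentz_norm_ge) (auto simp: r)
    also have "\<dots> = ennreal F"
      using pq c \<alpha>p cF by (subst nn_integral_lorentz_power) auto
    finally have adm: "\<phi> \<in> bellman_admissible M p q F f"
      using mass \<phi>0 by (simp add: bellman_admissible_def)
    have "ennreal (K \<theta> powr q / (q / p - \<alpha> * \<theta> * q))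
        = (\<integral>\<^sup>+t\<in>{0<..1}. ennreal (t powr (q / p - 1) * (K \<theta> * t powr - (\<alpha> * \<theta>)) powr q) \<partial>lborel)"
      using pq \<beta> K by (subst nn_integral_lorentz_power) auto
    also have "\<dots> \<le> ennpowr (lorentz_norm M p q (tree_maximal M T \<phi>)) q"
      using pq K by (intro lorentz_norm_ge R) auto
    also have "\<dots> \<le> bellman M T p q F f"
      unfolding bellman_def using adm by (rule SUP_upper)
    finally show ?thesis using adm by auto
  qed
  from main[of "1/2"] show "bellman_admissible M p q F f \<noteq> {}" by simp
  have "((\<lambda>\<theta>. K \<theta> powr q / (q / p - \<alpha> * \<theta> * q)) \<longlongrightarrow> (c * 1 powr (2 * (\<alpha> * 1)) / (1 - \<alpha> * 1)) powr q / (q / p - \<alpha> * 1 * q)) (at_left 1)"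
    unfolding K_def using c \<alpha> pos by (intro tendsto_intros) auto
  also have "(c * 1 powr (2 * (\<alpha> * 1)) / (1 - \<alpha> * 1)) powr q / (q / p - \<alpha> * 1 * q) = x powr q * F"
  proof -
    have "c / (1 - \<alpha>) = c * x" using x by (simp add: \<alpha>_def)
    then show ?thesis using x c by (simp add: powr_mult flip: cF)
  qed
  finally have "((\<lambda>\<theta>. ennreal (K \<theta> powr q / (q / p - \<alpha> * \<theta> * q))) \<longlongrightarrow> ennreal (x powr q * F)) (at_left 1)"
    by (rule tendsto_ennrealI)
  moreover have "eventually (\<lambda>\<theta>. ennreal (K \<theta> powr q / (q / p - \<alpha> * \<theta> * q)) \<le> bellman M T p q F f) (at_left 1)"
    using eventually_at_left_real[of 0 "1::real", simplified] by eventually_elim (use main in auto)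
  ultimately show "ennreal (x powr q * F) \<le> bellman M T p q F f"
    by (rule tendsto_upperbound) simp
qed

text \<open>\<open>weighted_average_le\<close> is applied at \<open>x = k * y\<close> with
  \<open>y\<close> decreasing to \<open>z\<close>: for \<open>z = 1\<close> its strict condition on
  \<open>x\<close> fails at \<open>z\<close> itself.\<close>

lemma bellman_le:
  assumes pq: "1 < p" "1 < q" and Ff: "0 < F" "0 < f" and z: "1 \<le> z" "z \<le> conj_exp q"
    and f: "f powr q = (conj_exp p / conj_exp q) powr (q - 1) * bellman_H q z * F"
  shows "bellman M T p q F f \<le> ennreal ((conj_exp p / conj_exp q * z) powr q * F)"
  unfolding bellman_def
proof (rule SUP_least)
  fix \<phi> assume "\<phi> \<in> bellman_admissible M p q F f"
  then obtain g where g: "decreasing_profile g f"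
    "(\<integral>\<^sup>+t\<in>{0<..1}. ennreal (t powr (q / p - 1) * g t powr q) \<partial>lborel) = ennreal F"
    "ennpowr (lorentz_norm M p q (tree_maximal M T \<phi>)) q \<le> decreasing_profile.weighted_average g p q"
    using pq Ff(2) by (rule admissible_profile)
  interpret decreasing_profile g f by (rule g)
  define k where "k = conj_exp p / conj_exp q"
  have k: "0 < k" using pq by (simp add: k_def conj_exp_def)
  have le: "weighted_average p q \<le> ennreal ((k * y) powr q * F)" if y: "1 < y" "z \<le> y" for y
  proof (rule weighted_average_le[OF pq])
    show "conj_exp p / conj_exp q < k * y" using k y unfolding k_def[symmetric] by simp
    have "bellman_H q y \<le> bellman_H q z"
      using bellman_H_strict_antimono[OF pq(2) z(1), of y] y by (cases "y = z") auto
    then have "k powr (q - 1) * bellman_H q y * F \<le> f powr q"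
      unfolding f k_def[symmetric] using Ff k by (intro mult_right_mono mult_left_mono) auto
    moreover have "k powr (q - 1) * bellman_H q y = q * (k * y) powr (q - 1) - q * (1 - 1 / p) * (k * y) powr q"
      unfolding k_def using y by (intro bellman_H_scale pq) auto
    ultimately show "F * (q * (k * y) powr (q - 1) - q * (1 - 1 / p) * (k * y) powr q) \<le> f powr q"
      by (simp add: mult.commute)
  qed (use Ff g in auto)
  have "weighted_average p q \<le> ennreal ((k * z) powr q * F)"
  proof (rule tendsto_lowerbound)
    show "((\<lambda>y. ennreal ((k * y) powr q * F)) \<longlongrightarrow> ennreal ((k * z) powr q * F)) (at_right z)"
      using k z by (intro tendsto_ennrealI tendsto_intros) auto
    show "eventually (\<lambda>y. weighted_average p q \<le> ennreal ((k * y) powr q * F)) (at_right z)"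
      using eventually_at_right_less[of z] by eventually_elim (use z in \<open>auto intro!: le\<close>)
  qed simp
  with g(3) show "ennpowr (lorentz_norm M p q (tree_maximal M T \<phi>)) q
      \<le> ennreal ((conj_exp p / conj_exp q * z) powr q * F)"
    by (simp add: k_def)
qed

lemma admissible_imp_le:
  assumes pq: "1 < p" "1 < q" and Ff: "0 < F" "0 < f" and ne: "bellman_admissible M p q F f \<noteq> {}"
  shows "f powr q \<le> (conj_exp p / conj_exp q) powr (q - 1) * F" "q < p \<Longrightarrow> f powr q \<le> q / p * F"
proof -
  from ne obtain \<phi> where "\<phi> \<in> bellman_admissible M p q F f" by auto
  then obtain g where g: "decreasing_profile g f"
    "(\<integral>\<^sup>+t\<in>{0<..1}. ennreal (t powr (q / p - 1) * g t powr q) \<partial>lborel) = ennreal F"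
    using pq Ff(2) by (rule admissible_profile)
  interpret decreasing_profile g f by (rule g)
  show "f powr q \<le> (conj_exp p / conj_exp q) powr (q - 1) * F"
    using Ff by (intro mass_power_le pq g) auto
  show "f powr q \<le> q / p * F" if "q < p"
    using Ff that by (intro mass_power_le' pq g) auto
qed

text \<open>For \<open>z\<close> with \<open>bellman_H q z\<close> equal to the argument of
  \<open>omega\<close>, and \<open>x = k * z\<close>, the identity required by
  \<open>bellman_ge\<close> holds, and \<open>bellman_le\<close> at the same \<open>z\<close> gives
  the same value from above.\<close>

lemma bellman_eq:
  assumes pq: "1 < p" "1 < q" and Ff: "0 < F" "0 < f"
    and le: "f powr q \<le> (conj_exp p / conj_exp q) powr (q - 1) * F" and le': "q < p \<Longrightarrow> f powr q \<le> q / p * F"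
  shows "bellman_admissible M p q F f \<noteq> {}"
    "bellman M T p q F f = ennreal ((conj_exp p / conj_exp q) powr q *
      (omega q ((conj_exp q / conj_exp p) powr (q - 1) * (f powr q / F))) powr q * F)"
proof -
  define k where "k = conj_exp p / conj_exp q"
  have k: "0 < k" using pq by (simp add: k_def conj_exp_def)
  define y where "y = (conj_exp q / conj_exp p) powr (q - 1) * (f powr q / F)"
  have inv: "(conj_exp q / conj_exp p) powr (q - 1) = 1 / k powr (q - 1)"
    using pq by (simp add: k_def powr_divide conj_exp_def mult.commute)
  have fy: "f powr q = k powr (q - 1) * y * F"
    using k Ff by (simp add: y_def inv)
  have y: "0 < y" "y \<le> 1"
    using k Ff le unfolding y_def inv k_def[symmetric] by (auto simp: field_simps)
  define z where "z = omega q y"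
  have bij: "bij_betw (bellman_H q) {1..conj_exp q} {0..1}" by (rule bij_betw_bellman_H[OF pq(2)])
  have Hz: "bellman_H q z = y"
    unfolding z_def omega_def using bij y by (intro f_the_inv_into_f_bij_betw[of _ _ "{0..1}"]) auto
  have "z \<in> {1..conj_exp q}"
    unfolding z_def omega_def using bij y
    by (intro the_inv_into_into[OF bij_betw_imp_inj_on[OF bij] _ order_refl]) (auto simp: bij_betw_def)
  then have z: "1 \<le> z" "z \<le> conj_exp q" by auto
  \<comment> \<open>\<open>z = conj_exp q\<close> would force \<open>y \<le> 0\<close>. Excluding it
    yields \<open>x < conj_exp p\<close>, the integrability condition for the power profile.\<close>
  have Hq: "bellman_H q (conj_exp q) \<le> 0"
  proof -
    have "conj_exp q powr q = conj_exp q * conj_exp q powr (q - 1)"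
      using pq by (simp add: powr_diff conj_exp_def)
    moreover have "(q - 1) * conj_exp q = q" using pq by (simp add: conj_exp_def)
    ultimately have "(q - 1) * conj_exp q powr q = q * conj_exp q powr (q - 1)"
      by (metis mult.assoc)
    then show ?thesis by (simp add: bellman_H_def algebra_simps)
  qed
  then have "z \<noteq> conj_exp q" using Hz y by auto
  then have z_less: "z < conj_exp q" using z by simp
  define x where "x = k * z"
  have "conj_exp p = k * conj_exp q" using pq by (simp add: k_def conj_exp_def)
  then have x_less: "x < conj_exp p" using z_less k by (simp add: x_def)
  have fx: "f powr q = F * (q * x powr (q - 1) - q * (1 - 1 / p) * x powr q)"
    using bellman_H_scale[OF pq, of z] z by (simp add: fy Hz x_def k_def mult.commute)
  \<comment> \<open>This makes the power profile non-increasing. For \<open>q < p\<close> it uses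
    the second domain condition: at \<open>z = 1 / k\<close>, that is at \<open>x = 1\<close>, the
    scaled \<open>bellman_H\<close> equals \<open>q / p\<close>.\<close>
  have x1: "1 \<le> x"
  proof (cases "q < p")
    case False
    then have "1 \<le> k" using pq by (simp add: k_def conj_exp_def field_simps)
    then have "1 * 1 \<le> k * z" using z by (intro mult_mono) auto
    then show ?thesis by (simp add: x_def)
  next
    case True
    show ?thesis
    proof (rule ccontr)
      assume "\<not> 1 \<le> x"
      then have "z < 1 / k" using k by (simp add: x_def field_simps)
      then have "bellman_H q (1 / k) < y"
        using bellman_H_strict_antimono[OF pq(2) z(1)] Hz by auto
      then have "k powr (q - 1) * bellman_H q (1 / k) * F < f powr q"
        unfolding fy using k Ff by (intro mult_strict_right_mono mult_strict_left_mono) auto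
      also have "k powr (q - 1) * bellman_H q (1 / k) = q / p"
        using bellman_H_scale[OF pq, of "1 / k"] k pq by (simp add: k_def[symmetric] algebra_simps)
      finally show False using le'[OF True] by simp
    qed
  qed
  show "bellman_admissible M p q F f \<noteq> {}" by (rule bellman_ge[OF pq Ff x1 x_less fx])
  have "bellman M T p q F f = ennreal (x powr q * F)"
  proof (rule antisym)
    show "ennreal (x powr q * F) \<le> bellman M T p q F f" by (rule bellman_ge[OF pq Ff x1 x_less fx])
    show "bellman M T p q F f \<le> ennreal (x powr q * F)"
      unfolding x_def k_def using fy Hz by (intro bellman_le pq Ff z) (simp add: k_def)
  qed
  also have "x powr q = k powr q * z powr q" using k z by (simp add: x_def powr_mult)
  finally show "bellman M T p q F f = ennreal ((conj_exp p / conj_exp q) powr q *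
      (omega q ((conj_exp q / conj_exp p) powr (q - 1) * (f powr q / F))) powr q * F)"
    by (simp add: z_def y_def k_def)
qed

end

lemma measure_tree_tree_space:
  assumes "prob_space M" "measure_tree M T"
  obtains C where "tree_space M T C"
proof -
  interpret prob_space M by fact
  obtain C where C: "\<forall>I\<in>T. C I \<subseteq> T \<and> finite (C I) \<and> 2 \<le> card (C I) \<and> (\<forall>J\<in>C I. J \<subseteq> I) \<and>
      pairwise (\<lambda>J K. emeasure M (J \<inter> K) = 0) (C I) \<and> I = \<Union>(C I)"
    "T = (\<Union>m. tree_level (space M) C m)"
    "(\<lambda>m. SUP I\<in>tree_level (space M) C m. emeasure M I) \<longlonglongrightarrow> 0"
    using assms(2) unfolding measure_tree_def by (elim conjE exE) (rule that)
  note CI = C(1)[rule_format]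
  have "tree_space M T C"
  proof
    show "T \<subseteq> sets M" "space M \<in> T" "\<And>I. I \<in> T \<Longrightarrow> 0 < emeasure M I"
      using assms(2) by (auto simp: measure_tree_def)
    fix I assume I: "I \<in> T"
    show "C I \<subseteq> T" "finite (C I)" "pairwise (\<lambda>J K. emeasure M (J \<inter> K) = 0) (C I)" "I = \<Union>(C I)"
      using CI[OF I] by simp_all
    show "J \<subseteq> I" if "J \<in> C I" for J
      using CI[OF I] that by simp
  qed (fact C)+
  then show thesis by (rule that)
qed

theorem theorem4:
  fixes M :: "'a measure" and T :: "'a set set" and p q :: real
  assumes "prob_space M" and "nonatomic M" and "measure_tree M T"
    and "1 < p" and "1 < q"
  shows "(p \<le> q \<longrightarrow> bellman_domain M p q =
            {(F, f). 0 < F \<and> 0 < f \<and> 0 < f powr q \<and>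
                     f powr q \<le> (conj_exp p / conj_exp q) powr (q - 1) * F}) \<and>
         (q < p \<longrightarrow> bellman_domain M p q =
            {(F, f). 0 < F \<and> 0 < f \<and> 0 < f powr q \<and> f powr q \<le> q / p * F}) \<and>
         (\<forall>(F, f)\<in>bellman_domain M p q.
            bellman M T p q F f =
              ennreal ((conj_exp p / conj_exp q) powr q *
                (omega q ((conj_exp q / conj_exp p) powr (q - 1) * (f powr q / F))) powr q * F))"
proof -
  obtain C where "tree_space M T C" using assms(1,3) by (rule measure_tree_tree_space)
  then interpret tree_space M T C .
  define k where "k = conj_exp p / conj_exp q"
  have k: "0 < k" using assms(4,5) by (simp add: k_def conj_exp_def)
  \<comment> \<open>For \<open>q < p\<close> the domain condition with \<open>q / p\<close> implies
    the other one, because \<open>1 / k \<ge> 1\<close> and \<open>bellman_H\<close> decreases from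
    its value 1 at 1.\<close>
  have q_le_k: "q / p \<le> k powr (q - 1)" if "q < p"
  proof -
    have "1 \<le> 1 / k" using assms(4,5) that by (simp add: k_def conj_exp_def field_simps)
    then have "bellman_H q (1 / k) \<le> bellman_H q 1"
      unfolding order.order_iff_strict[of 1] using bellman_H_strict_antimono[OF assms(5), of 1 "1 / k"] by (metis order.refl less_imp_le)
    then have "k powr (q - 1) * bellman_H q (1 / k) \<le> k powr (q - 1) * 1"
      using k by (intro mult_left_mono) (auto simp: bellman_H_def)
    moreover have "k powr (q - 1) * bellman_H q (1 / k) = q / p"
      using bellman_H_scale[OF assms(4,5), of "1 / k"] k assms(4,5)
      by (simp add: k_def[symmetric] algebra_simps)
    ultimately show ?thesis by simp
  qed
  have dom: "(F, f) \<in> bellman_domain M p q \<longleftrightarrow>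
      0 < F \<and> 0 < f \<and> f powr q \<le> k powr (q - 1) * F \<and> (q < p \<longrightarrow> f powr q \<le> q / p * F)" for F f
    using bellman_eq(1)[OF assms(4,5), of F f] admissible_imp_le[OF assms(4,5), of F f]
    unfolding bellman_domain_def k_def by blast
  have dom': "(F, f) \<in> bellman_domain M p q \<longleftrightarrow> 0 < F \<and> 0 < f \<and> f powr q \<le> q / p * F" if "q < p" for F f
    using dom that mult_right_mono[OF q_le_k[OF that], of F] by fastforce
  have "bellman M T p q F f = ennreal ((conj_exp p / conj_exp q) powr q *
      (omega q ((conj_exp q / conj_exp p) powr (q - 1) * (f powr q / F))) powr q * F)"
    if "(F, f) \<in> bellman_domain M p q" for F f
    using that unfolding dom k_def by (intro bellman_eq(2) assms(4,5)) auto
  moreover have "bellman_domain M p q = {(F, f). 0 < F \<and> 0 < f \<and> 0 < f powr q \<and> f powr q \<le> k powr (q - 1) * F}" if "p \<le> q"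
    using dom that by auto
  moreover have "bellman_domain M p q = {(F, f). 0 < F \<and> 0 < f \<and> 0 < f powr q \<and> f powr q \<le> q / p * F}" if "q < p"
    using dom'[OF that] by auto
  ultimately show ?thesis unfolding k_def by blast
qed

end
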